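(* Let $R$ be a ring and let $\star\in\{\circ,\bullet,\vee\}$. Let $\tau_\circ={\uparrow\uparrow\uparrow}$, $\tau_\bullet={\downarrow\uparrow\downarrow}$, and $\tau_\vee={\uparrow\downarrow\downarrow}$. (i) The operation $\star$ (on module representations and on triples of module homomorphisms) defines functors $\mathsf{mrep}(R)\to\mathsf{mrep}_{\tau_\star}(R)$ and $\mathsf{mrep}_{\tau_\star}(R)\to\mathsf{mrep}(R)$, as well as functors $\mathsf{mrep}_{\downarrow\downarrow\downarrow}(R)\to\mathsf{mrep}_{\bar\tau_\star}(R)$ and $\mathsf{mrep}_{\bar\tau_\star}(R)\to\mathsf{mrep}_{\downarrow\downarrow\downarrow}(R)$. (ii) By (i), $(\cdot)^{\star\star}$ defines an endofunctor of each of $\mathsf{mrep}(R)$, $\mathsf{mrep}_{\downarrow\downarrow\downarrow}(R)$, $\mathsf{mrep}_{\tau_\star}(R)$, and $\mathsf{mrep}_{\bar\tau_\star}(R)$. In each case, we obtain a natural transformation $\eta^\star\colon\mathrm{Id}\to(\cdot)^{\star\star}$ whose component at a module representation $\theta\colon M\to\operatorname{Hom}(V,W)$ over $R$ is the triple $(\nu_\theta,\phi_\theta,\psi_\theta)$ given as follows: - for $\star=\circ$: $(\nu_\theta,\phi_\theta,\psi_\theta)=(\mathrm{id}_M,\mathrm{id}_V,\mathrm{id}_W)$; - for $\star=\bullet$: $(\nu_\theta,\phi_\theta,\psi_\theta)=(\varepsilon_M,\mathrm{id}_V,\varepsilon_W)$; - for $\star=\vee$: $(\nu_\theta,\phi_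\theta,\psi_\theta)=(\mathrm{id}_M,\varepsilon_V,\varepsilon_W)$.
   Context: Rings are associative, commutative, and unital. Maps act on the right. A module representation over $R$ is an $R$-module homomorphism $\theta\colon M\to\operatorname{Hom}(V,W)$ with $M,V,W$ arbitrary $R$-modules; its multiplication is $V\times M\to W$, $x*_\theta a = x(a\theta)$. Let $\tau=\tau_1\tau_2\tau_3$ be a string over $\{\uparrow,\downarrow\}$; let $\bar\tau$ be obtained from $\tau$ by interchanging $\uparrow$ and $\downarrow$ in every position. The category $\mathsf{mrep}_\tau(R)$ has the module representations over $R$ as objects. Its morphisms ($\tau$-morphisms) from $\theta\colon M\to\operatorname{Hom}(V,W)$ to $\tilde\theta\colon\tilde M\to\operatorname{Hom}(\tilde V,\tilde W)$ are triples of $R$-homomorphisms between $M$ and $\tilde M$, between $V$ and $\tilde V$, and between $W$ and $\tilde W$, where the $i$th homomorphism goes from the untilded to the tilded module if $\tau_i={\uparrow}$ and in the reverse direction if $\tau_i={\downarrow}$, subject to the following condition: - $\uparrow\uparrow\uparrow$: $(\nu\colon M\to\tilde M,\ \phi\colon V\to\tilde V,\ \psi\colon W\to\tilde W)$ with $(x*_\theta a)\psi=(x\phi)*_{\tilde\theta}(a\nu)$ for all $a\in M,x\in V$. - $\downarrow\downarrow\uparrow$: $(\tilde\nu\colon\tilde M\to M,\ \tilde\phi\colon\tilde V\to V,\ \psi\colon W\to\tilde W)$ with $\tilde x*_{\tilde\theta}\tilde a=(\tilde x\tilde\phi*_\theta\tilde a\tilde\nu)\psi$ for all $\tilde a\in\tilde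 M,\tilde x\in\tilde V$. - $\uparrow\downarrow\downarrow$: $(\nu\colon M\to\tilde M,\ \tilde\phi\colon\tilde V\to V,\ \tilde\psi\colon\tilde W\to W)$ with $\tilde x\tilde\phi*_\theta a=(\tilde x*_{\tilde\theta}a\nu)\tilde\psi$ for all $a\in M,\tilde x\in\tilde V$. - $\downarrow\uparrow\downarrow$: $(\tilde\nu\colon\tilde M\to M,\ \phi\colon V\to\tilde V,\ \tilde\psi\colon\tilde W\to W)$ with $x*_\theta\tilde a\tilde\nu=(x\phi*_{\tilde\theta}\tilde a)\tilde\psi$ for all $\tilde a\in\tilde M,x\in V$. - A $\bar\tau$-morphism $\theta\to\tilde\theta$ is a $\tau$-morphism $\tilde\theta\to\theta$, so $\mathsf{mrep}_{\bar\tau}(R)=\mathsf{mrep}_\tau(R)^{\mathrm{op}}$. Composition is componentwise. Write $\mathsf{mrep}(R)=\mathsf{mrep}_{\uparrow\uparrow\uparrow}(R)$. Write $U^*=\operatorname{Hom}(U,R)$ and let $\varepsilon_U\colon U\to U^{**}$, $u\mapsto(\phi\mapsto u\phi)$, be the evaluation map. For a module representation $\theta\colon M\to\operatorname{Hom}(V,W)$ define $\theta^\circ\colon V\to\operatorname{Hom}(M,W)$, $x\mapsto(a\mapsto x(a\theta))$; $\theta^\bullet\colon W^*\to\operatorname{Hom}(V,M^* )$, $\psi\mapsto(x\mapsto(a\mapsto(x(a\theta))\psi))$; $\theta^\vee\colon M\to\operatorname{Hom}(W^*,V^* )$, $a\mapsto(\psi\mapsto(x\mapsto(x(a\theta))\psi))$.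 For a triple of $R$-module homomorphisms define $(\nu,\phi,\psi)^\circ=(\phi,\nu,\psi)$, $(\nu,\phi,\psi)^\bullet=(\psi^*,\phi,\nu^* )$, $(\nu,\phi,\psi)^\vee=(\nu,\psi^*,\phi^* )$, where $(\cdot)^*$ denotes the dual homomorphism.
   Formalization: For ⋆ = • and ∨, in mrep_↓↓↓(R) and mrep_{τ_⋆}(R) the given triple is shown to be a natural transformation (·)^⋆⋆ → Id instead of Id → (·)^⋆⋆, because evaluation maps U → U** point the wrong way for the stated direction there. *)

theory Defs
  imports "HOL-Algebra.Module"
begin

section \<open>Hom modules, duals, evaluation maps\<close>

text \<open>
  Homomorphisms are extensional (undefined off the carrier of the source), so that HOL equality
  of homomorphisms is equality of maps. Only the additive group and the scalar multiplication of a
  \<open>module\<close> record matter; its ring fields \<open>mult\<close> and \<open>one\<close> are junk.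
\<close>

definition mod_hom ::
  "('r, 'z) ring_scheme \<Rightarrow> ('r, 'a) module \<Rightarrow> ('r, 'b) module \<Rightarrow> ('a \<Rightarrow> 'b) set" where
  "mod_hom R A B = {f \<in> carrier A \<rightarrow>\<^sub>E carrier B.
     (\<forall>x\<in>carrier A. \<forall>y\<in>carrier A. f (x \<oplus>\<^bsub>A\<^esub> y) = f x \<oplus>\<^bsub>B\<^esub> f y) \<and>
     (\<forall>r\<in>carrier R. \<forall>x\<in>carrier A. f (r \<odot>\<^bsub>A\<^esub> x) = r \<odot>\<^bsub>B\<^esub> f x)}"

definition hom_module ::
  "('r, 'z) ring_scheme \<Rightarrow> ('r, 'a) module \<Rightarrow> ('r, 'b) module \<Rightarrow> ('r, 'a \<Rightarrow> 'b) module" where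
  "hom_module R A B =
     \<lparr>carrier = mod_hom R A B, mult = undefined, one = undefined,
      zero = (\<lambda>x\<in>carrier A. \<zero>\<^bsub>B\<^esub>),
      add = (\<lambda>f g. \<lambda>x\<in>carrier A. f x \<oplus>\<^bsub>B\<^esub> g x),
      smult = (\<lambda>r f. \<lambda>x\<in>carrier A. r \<odot>\<^bsub>B\<^esub> f x)\<rparr>"

definition self_module :: "('r, 'z) ring_scheme \<Rightarrow> ('r, 'r) module" where
  "self_module R =
     \<lparr>carrier = carrier R, mult = mult R, one = \<one>\<^bsub>R\<^esub>, zero = \<zero>\<^bsub>R\<^esub>, add = add R,
      smult = mult R\<rparr>"

definition dual_module :: "('r, 'z) ring_scheme \<Rightarrow> ('r, 'a) module \<Rightarrow> ('r, 'a \<Rightarrow> 'r) module" where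
  "dual_module R U = hom_module R U (self_module R)"

definition dual_map ::
  "('r, 'z) ring_scheme \<Rightarrow> ('r, 'a) module \<Rightarrow> ('r, 'b) module \<Rightarrow> ('a \<Rightarrow> 'b) \<Rightarrow>
   ('b \<Rightarrow> 'r) \<Rightarrow> ('a \<Rightarrow> 'r)" where
  "dual_map R A B f = (\<lambda>\<chi>\<in>carrier (dual_module R B). \<lambda>x\<in>carrier A. \<chi> (f x))"

definition eval_map :: "('r, 'z) ring_scheme \<Rightarrow> ('r, 'a) module \<Rightarrow> 'a \<Rightarrow> ('a \<Rightarrow> 'r) \<Rightarrow> 'r" where
  "eval_map R U = (\<lambda>u\<in>carrier U. \<lambda>\<phi>\<in>carrier (dual_module R U). \<phi> u)"

section \<open>Module representations\<close>

record ('r, 'm, 'v, 'w) mrep =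
  modM :: "('r, 'm) module"
  modV :: "('r, 'v) module"
  modW :: "('r, 'w) module"
  rep :: "'m \<Rightarrow> 'v \<Rightarrow> 'w"

definition module_rep :: "('r, 'z) ring_scheme \<Rightarrow> ('r, 'm, 'v, 'w) mrep \<Rightarrow> bool" where
  "module_rep R \<theta> \<longleftrightarrow>
     module R (modM \<theta>) \<and> module R (modV \<theta>) \<and> module R (modW \<theta>) \<and>
     rep \<theta> \<in> mod_hom R (modM \<theta>) (hom_module R (modV \<theta>) (modW \<theta>))"

definition mrep_mult :: "('r, 'm, 'v, 'w) mrep \<Rightarrow> 'v \<Rightarrow> 'm \<Rightarrow> 'w" where
  "mrep_mult \<theta> x a = rep \<theta> a x"

section \<open>The categories of module representations\<close>

datatype dir = Up ("\<up>") | Down ("\<down>")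

fun opp :: "dir \<Rightarrow> dir" where
  "opp \<up> = \<down>"
| "opp \<down> = \<up>"

type_synonym dirs = "dir \<times> dir \<times> dir"

fun bar :: "dirs \<Rightarrow> dirs" where
  "bar (a, b, c) = (opp a, opp b, opp c)"

text \<open>
  A component of a \<open>\<tau>\<close>-morphism is a map together with its direction: for an arrow from \<open>A\<close> to \<open>B\<close>,
  \<open>Fwd f\<close> carries a homomorphism \<open>f\<close> from \<open>A\<close> to \<open>B\<close> and \<open>Bwd f\<close> one from \<open>B\<close> to \<open>A\<close>.
\<close>

datatype ('a, 'b) arrow = Fwd "'a \<Rightarrow> 'b" | Bwd "'b \<Rightarrow> 'a"

type_synonym ('m, 'v, 'w, 'm2, 'v2, 'w2) arrows = "('m, 'm2) arrow \<times> ('v, 'v2) arrow \<times> ('w, 'w2) arrow"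

fun arrow_hom ::
  "('r, 'z) ring_scheme \<Rightarrow> dir \<Rightarrow> ('r, 'a) module \<Rightarrow> ('r, 'b) module \<Rightarrow> ('a, 'b) arrow set" where
  "arrow_hom R \<up> A B = Fwd ` mod_hom R A B"
| "arrow_hom R \<down> A B = Bwd ` mod_hom R B A"

fun arrow_rev :: "('a, 'b) arrow \<Rightarrow> ('b, 'a) arrow" where
  "arrow_rev (Fwd f) = Bwd f"
| "arrow_rev (Bwd f) = Fwd f"

fun arrow_id :: "dir \<Rightarrow> ('r, 'a) module \<Rightarrow> ('a, 'a) arrow" where
  "arrow_id \<up> A = Fwd (\<lambda>x\<in>carrier A. x)"
| "arrow_id \<down> A = Bwd (\<lambda>x\<in>carrier A. x)"

text \<open>
  Composition in diagrammatic order of an arrow from \<open>A\<close> to \<open>B\<close> and one from \<open>B\<close> to \<open>C\<close>.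
\<close>

fun arrow_comp ::
  "('r, 'a) module \<Rightarrow> ('r, 'c) module \<Rightarrow> ('a, 'b) arrow \<Rightarrow> ('b, 'c) arrow \<Rightarrow> ('a, 'c) arrow" where
  "arrow_comp A C (Fwd f) (Fwd g) = Fwd (compose (carrier A) g f)"
| "arrow_comp A C (Bwd f) (Bwd g) = Bwd (compose (carrier C) f g)"
| "arrow_comp A C _ _ = undefined"

text \<open>
  The dual of an arrow from \<open>A\<close> to \<open>B\<close>, as an arrow from \<open>A\<^sup>*\<close> to \<open>B\<^sup>*\<close>; dualizing reverses the direction.
\<close>

fun arrow_dual ::
  "('r, 'z) ring_scheme \<Rightarrow> ('r, 'a) module \<Rightarrow> ('r, 'b) module \<Rightarrow> ('a, 'b) arrow \<Rightarrow>
   ('a \<Rightarrow> 'r, 'b \<Rightarrow> 'r) arrow" where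
  "arrow_dual R A B (Fwd f) = Bwd (dual_map R A B f)"
| "arrow_dual R A B (Bwd f) = Fwd (dual_map R B A f)"

fun arrows_rev ::
  "('m, 'v, 'w, 'm2, 'v2, 'w2) arrows \<Rightarrow> ('m2, 'v2, 'w2, 'm, 'v, 'w) arrows" where
  "arrows_rev (p, q, s) = (arrow_rev p, arrow_rev q, arrow_rev s)"

definition basic_dirs :: "dirs set" where
  "basic_dirs = {(\<up>, \<up>, \<up>), (\<down>, \<down>, \<up>), (\<up>, \<down>, \<down>), (\<down>, \<up>, \<down>)}"

fun compat ::
  "('r, 'm, 'v, 'w) mrep \<Rightarrow> ('r, 'm2, 'v2, 'w2) mrep \<Rightarrow>
   ('m, 'v, 'w, 'm2, 'v2, 'w2) arrows \<Rightarrow> bool" where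
  "compat \<theta> \<theta>' (Fwd \<nu>, Fwd \<phi>, Fwd \<psi>) \<longleftrightarrow>
     (\<forall>a\<in>carrier (modM \<theta>). \<forall>x\<in>carrier (modV \<theta>).
        \<psi> (mrep_mult \<theta> x a) = mrep_mult \<theta>' (\<phi> x) (\<nu> a))"
| "compat \<theta> \<theta>' (Bwd \<nu>, Bwd \<phi>, Fwd \<psi>) \<longleftrightarrow>
     (\<forall>a\<in>carrier (modM \<theta>'). \<forall>x\<in>carrier (modV \<theta>').
        mrep_mult \<theta>' x a = \<psi> (mrep_mult \<theta> (\<phi> x) (\<nu> a)))"
| "compat \<theta> \<theta>' (Fwd \<nu>, Bwd \<phi>, Bwd \<psi>) \<longleftrightarrow>
     (\<forall>a\<in>carrier (modM \<theta>). \<forall>x\<in>carrier (modV \<theta>').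
        mrep_mult \<theta> (\<phi> x) a = \<psi> (mrep_mult \<theta>' x (\<nu> a)))"
| "compat \<theta> \<theta>' (Bwd \<nu>, Fwd \<phi>, Bwd \<psi>) \<longleftrightarrow>
     (\<forall>a\<in>carrier (modM \<theta>'). \<forall>x\<in>carrier (modV \<theta>).
        mrep_mult \<theta> x (\<nu> a) = \<psi> (mrep_mult \<theta>' (\<phi> x) a))"
| "compat \<theta> \<theta>' _ \<longleftrightarrow> False"

definition basic_hom ::
  "('r, 'z) ring_scheme \<Rightarrow> dirs \<Rightarrow> ('r, 'm, 'v, 'w) mrep \<Rightarrow> ('r, 'm2, 'v2, 'w2) mrep \<Rightarrow>
   ('m, 'v, 'w, 'm2, 'v2, 'w2) arrows set" where
  "basic_hom R \<tau> \<theta> \<theta>' = {(p, q, s).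
     p \<in> arrow_hom R (fst \<tau>) (modM \<theta>) (modM \<theta>') \<and>
     q \<in> arrow_hom R (fst (snd \<tau>)) (modV \<theta>) (modV \<theta>') \<and>
     s \<in> arrow_hom R (snd (snd \<tau>)) (modW \<theta>) (modW \<theta>') \<and>
     compat \<theta> \<theta>' (p, q, s)}"

text \<open>
  For the four remaining strings, a morphism from \<open>\<theta>\<close> to \<open>\<theta>'\<close> is a morphism from \<open>\<theta>'\<close> to \<open>\<theta>\<close> for the
  opposite string. The triple of maps is the same; \<^const>\<open>arrows_rev\<close> only exchanges the tags.
\<close>

definition mrep_hom ::
  "('r, 'z) ring_scheme \<Rightarrow> dirs \<Rightarrow> ('r, 'm, 'v, 'w) mrep \<Rightarrow> ('r, 'm2, 'v2, 'w2) mrep \<Rightarrow>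
   ('m, 'v, 'w, 'm2, 'v2, 'w2) arrows set" where
  "mrep_hom R \<tau> \<theta> \<theta>' =
     (if \<tau> \<in> basic_dirs then basic_hom R \<tau> \<theta> \<theta>'
      else {t. arrows_rev t \<in> basic_hom R (bar \<tau>) \<theta>' \<theta>})"

fun mrep_id :: "dirs \<Rightarrow> ('r, 'm, 'v, 'w) mrep \<Rightarrow> ('m, 'v, 'w, 'm, 'v, 'w) arrows" where
  "mrep_id (a, b, c) \<theta> = (arrow_id a (modM \<theta>), arrow_id b (modV \<theta>), arrow_id c (modW \<theta>))"

text \<open>\<open>\<theta>\<close> is the source of the first and \<open>\<theta>'\<close> the target of the second morphism.\<close>

fun mrep_comp ::
  "('r, 'm, 'v, 'w) mrep \<Rightarrow> ('r, 'm3, 'v3, 'w3) mrep \<Rightarrow>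
   ('m, 'v, 'w, 'm2, 'v2, 'w2) arrows \<Rightarrow> ('m2, 'v2, 'w2, 'm3, 'v3, 'w3) arrows \<Rightarrow>
   ('m, 'v, 'w, 'm3, 'v3, 'w3) arrows" where
  "mrep_comp \<theta> \<theta>' (p, q, s) (p', q', s') =
     (arrow_comp (modM \<theta>) (modM \<theta>') p p',
      arrow_comp (modV \<theta>) (modV \<theta>') q q',
      arrow_comp (modW \<theta>) (modW \<theta>') s s')"

section \<open>Functors and natural transformations\<close>

text \<open>
  There is no HOL type of all \<open>R\<close>-modules, and dualizing changes the carrier type. The category
  for a string \<open>\<sigma>\<close> is therefore the polymorphic family given by \<^const>\<open>module_rep\<close>, \<^const>\<open>mrep_hom\<close>,
  \<^const>\<open>mrep_id\<close> and \<^const>\<open>mrep_comp\<close>, with morphisms between representations on arbitrary, possibly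
  different, carrier types. A functor is a polymorphic operation on objects and morphisms. As HOL
  functions passed as arguments are monomorphic, the functor laws take as arguments the instances of
  such an operation at three unrelated triples of carrier types: \<open>Fi\<close> is the object map for the
  \<open>i\<close>-th triple and \<open>Fij\<close> the morphism map for morphisms from the \<open>i\<close>-th to the \<open>j\<close>-th. The morphism map
  also receives source and target, which are needed to form duals of homomorphisms.
\<close>

definition mrep_functor where
  "mrep_functor R \<sigma> \<sigma>' F1 F2 F3 F11 F12 F23 F13 \<longleftrightarrow>
     (\<forall>\<theta>1. module_rep R \<theta>1 \<longrightarrow> module_rep R (F1 \<theta>1)) \<and>
     (\<forall>\<theta>1 \<theta>2. \<forall>f \<in> mrep_hom R \<sigma> \<theta>1 \<theta>2. module_rep R \<theta>1 \<and> module_rep R \<theta>2 \<longrightarrow>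
        F12 \<theta>1 \<theta>2 f \<in> mrep_hom R \<sigma>' (F1 \<theta>1) (F2 \<theta>2)) \<and>
     (\<forall>\<theta>1. module_rep R \<theta>1 \<longrightarrow> F11 \<theta>1 \<theta>1 (mrep_id \<sigma> \<theta>1) = mrep_id \<sigma>' (F1 \<theta>1)) \<and>
     (\<forall>\<theta>1 \<theta>2 \<theta>3. \<forall>f \<in> mrep_hom R \<sigma> \<theta>1 \<theta>2. \<forall>g \<in> mrep_hom R \<sigma> \<theta>2 \<theta>3.
        module_rep R \<theta>1 \<and> module_rep R \<theta>2 \<and> module_rep R \<theta>3 \<longrightarrow>
        F13 \<theta>1 \<theta>3 (mrep_comp \<theta>1 \<theta>3 f g) =
        mrep_comp (F1 \<theta>1) (F3 \<theta>3) (F12 \<theta>1 \<theta>2 f) (F23 \<theta>2 \<theta>3 g))"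

text \<open>
  Likewise a natural transformation \<open>\<eta>\<close> from \<open>F\<close> to \<open>G\<close>, two endofunctors of the category for \<open>\<sigma>\<close>, with
  instances at two unrelated triples of carrier types.
\<close>

definition mrep_nat_trans where
  "mrep_nat_trans R \<sigma> F1 F2 F12 G1 G2 G12 \<eta>1 \<eta>2 \<longleftrightarrow>
     (\<forall>\<theta>1. module_rep R \<theta>1 \<longrightarrow> \<eta>1 \<theta>1 \<in> mrep_hom R \<sigma> (F1 \<theta>1) (G1 \<theta>1)) \<and>
     (\<forall>\<theta>1 \<theta>2. \<forall>f \<in> mrep_hom R \<sigma> \<theta>1 \<theta>2. module_rep R \<theta>1 \<and> module_rep R \<theta>2 \<longrightarrow>
        mrep_comp (F1 \<theta>1) (G2 \<theta>2) (F12 \<theta>1 \<theta>2 f) (\<eta>2 \<theta>2) =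
        mrep_comp (F1 \<theta>1) (G2 \<theta>2) (\<eta>1 \<theta>1) (G12 \<theta>1 \<theta>2 f))"

definition id_ob :: "('r, 'm, 'v, 'w) mrep \<Rightarrow> ('r, 'm, 'v, 'w) mrep" where
  "id_ob \<theta> = \<theta>"

definition id_mor ::
  "('r, 'm, 'v, 'w) mrep \<Rightarrow> ('r, 'm2, 'v2, 'w2) mrep \<Rightarrow>
   ('m, 'v, 'w, 'm2, 'v2, 'w2) arrows \<Rightarrow> ('m, 'v, 'w, 'm2, 'v2, 'w2) arrows" where
  "id_mor \<theta> \<theta>' t = t"

section \<open>The three operations\<close>

definition circ :: "('r, 'm, 'v, 'w) mrep \<Rightarrow> ('r, 'v, 'm, 'w) mrep" where
  "circ \<theta> =
     \<lparr>modM = modV \<theta>, modV = modM \<theta>, modW = modW \<theta>,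
      rep = (\<lambda>x\<in>carrier (modV \<theta>). \<lambda>a\<in>carrier (modM \<theta>). rep \<theta> a x)\<rparr>"

definition bullet ::
  "('r, 'z) ring_scheme \<Rightarrow> ('r, 'm, 'v, 'w) mrep \<Rightarrow> ('r, 'w \<Rightarrow> 'r, 'v, 'm \<Rightarrow> 'r) mrep" where
  "bullet R \<theta> =
     \<lparr>modM = dual_module R (modW \<theta>), modV = modV \<theta>, modW = dual_module R (modM \<theta>),
      rep = (\<lambda>\<psi>\<in>carrier (dual_module R (modW \<theta>)). \<lambda>x\<in>carrier (modV \<theta>). \<lambda>a\<in>carrier (modM \<theta>).
               \<psi> (rep \<theta> a x))\<rparr>"

definition vee ::
  "('r, 'z) ring_scheme \<Rightarrow> ('r, 'm, 'v, 'w) mrep \<Rightarrow> ('r, 'm, 'w \<Rightarrow> 'r, 'v \<Rightarrow> 'r) mrep" where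
  "vee R \<theta> =
     \<lparr>modM = modM \<theta>, modV = dual_module R (modW \<theta>), modW = dual_module R (modV \<theta>),
      rep = (\<lambda>a\<in>carrier (modM \<theta>). \<lambda>\<psi>\<in>carrier (dual_module R (modW \<theta>)). \<lambda>x\<in>carrier (modV \<theta>).
               \<psi> (rep \<theta> a x))\<rparr>"

fun circ_mor ::
  "('r, 'm, 'v, 'w) mrep \<Rightarrow> ('r, 'm2, 'v2, 'w2) mrep \<Rightarrow>
   ('m, 'v, 'w, 'm2, 'v2, 'w2) arrows \<Rightarrow> ('v, 'm, 'w, 'v2, 'm2, 'w2) arrows" where
  "circ_mor \<theta> \<theta>' (p, q, s) = (q, p, s)"

fun bullet_mor ::
  "('r, 'z) ring_scheme \<Rightarrow> ('r, 'm, 'v, 'w) mrep \<Rightarrow> ('r, 'm2, 'v2, 'w2) mrep \<Rightarrow>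
   ('m, 'v, 'w, 'm2, 'v2, 'w2) arrows \<Rightarrow>
   ('w \<Rightarrow> 'r, 'v, 'm \<Rightarrow> 'r, 'w2 \<Rightarrow> 'r, 'v2, 'm2 \<Rightarrow> 'r) arrows" where
  "bullet_mor R \<theta> \<theta>' (p, q, s) =
     (arrow_dual R (modW \<theta>) (modW \<theta>') s, q, arrow_dual R (modM \<theta>) (modM \<theta>') p)"

fun vee_mor ::
  "('r, 'z) ring_scheme \<Rightarrow> ('r, 'm, 'v, 'w) mrep \<Rightarrow> ('r, 'm2, 'v2, 'w2) mrep \<Rightarrow>
   ('m, 'v, 'w, 'm2, 'v2, 'w2) arrows \<Rightarrow>
   ('m, 'w \<Rightarrow> 'r, 'v \<Rightarrow> 'r, 'm2, 'w2 \<Rightarrow> 'r, 'v2 \<Rightarrow> 'r) arrows" where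
  "vee_mor R \<theta> \<theta>' (p, q, s) =
     (p, arrow_dual R (modW \<theta>) (modW \<theta>') s, arrow_dual R (modV \<theta>) (modV \<theta>') q)"

definition circ2 :: "('r, 'm, 'v, 'w) mrep \<Rightarrow> ('r, 'm, 'v, 'w) mrep" where
  "circ2 \<theta> = circ (circ \<theta>)"

definition circ2_mor ::
  "('r, 'm, 'v, 'w) mrep \<Rightarrow> ('r, 'm2, 'v2, 'w2) mrep \<Rightarrow>
   ('m, 'v, 'w, 'm2, 'v2, 'w2) arrows \<Rightarrow> ('m, 'v, 'w, 'm2, 'v2, 'w2) arrows" where
  "circ2_mor \<theta> \<theta>' t = circ_mor (circ \<theta>) (circ \<theta>') (circ_mor \<theta> \<theta>' t)"

definition bullet2 ::
  "('r, 'z) ring_scheme \<Rightarrow> ('r, 'm, 'v, 'w) mrep \<Rightarrow>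
   ('r, ('m \<Rightarrow> 'r) \<Rightarrow> 'r, 'v, ('w \<Rightarrow> 'r) \<Rightarrow> 'r) mrep" where
  "bullet2 R \<theta> = bullet R (bullet R \<theta>)"

definition bullet2_mor where
  "bullet2_mor R \<theta> \<theta>' t = bullet_mor R (bullet R \<theta>) (bullet R \<theta>') (bullet_mor R \<theta> \<theta>' t)"

definition vee2 ::
  "('r, 'z) ring_scheme \<Rightarrow> ('r, 'm, 'v, 'w) mrep \<Rightarrow>
   ('r, 'm, ('v \<Rightarrow> 'r) \<Rightarrow> 'r, ('w \<Rightarrow> 'r) \<Rightarrow> 'r) mrep" where
  "vee2 R \<theta> = vee R (vee R \<theta>)"

definition vee2_mor where
  "vee2_mor R \<theta> \<theta>' t = vee_mor R (vee R \<theta>) (vee R \<theta>') (vee_mor R \<theta> \<theta>' t)"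

definition \<tau>_circ :: dirs where "\<tau>_circ = (\<up>, \<up>, \<up>)"
definition \<tau>_bullet :: dirs where "\<tau>_bullet = (\<down>, \<up>, \<down>)"
definition \<tau>_vee :: dirs where "\<tau>_vee = (\<up>, \<down>, \<down>)"

text \<open>
  The triples \<open>\<eta>\<^sub>\<theta>\<close>. An identity map serves in either direction and is tagged as \<open>\<sigma>\<close> demands,
  whereas an evaluation map \<open>\<epsilon>\<^sub>U\<close> only goes from \<open>U\<close> to \<open>U\<^sup>*\<^sup>*\<close>. Hence, for \<open>\<star>\<close> one of bullet and
  vee, the triple is a \<open>\<sigma>\<close>-morphism from \<open>\<theta>\<close> to \<open>\<theta>\<^sup>\<star>\<^sup>\<star>\<close> only if \<open>\<sigma>\<close> has an up-arrow at the positions of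
  the evaluation maps, namely for \<open>\<up>\<up>\<up>\<close> and the opposite of \<open>\<tau>\<^sub>\<star>\<close>. For the two opposite strings, \<open>\<down>\<down>\<down>\<close>
  and \<open>\<tau>\<^sub>\<star>\<close>, the same triple is a morphism from \<open>\<theta>\<^sup>\<star>\<^sup>\<star>\<close> to \<open>\<theta>\<close>.
\<close>

definition eta_circ :: "dirs \<Rightarrow> ('r, 'm, 'v, 'w) mrep \<Rightarrow> ('m, 'v, 'w, 'm, 'v, 'w) arrows" where
  "eta_circ \<sigma> \<theta> =
     (arrow_id (fst \<sigma>) (modM \<theta>), arrow_id (fst (snd \<sigma>)) (modV \<theta>), arrow_id (snd (snd \<sigma>)) (modW \<theta>))"

definition eta_bullet ::
  "('r, 'z) ring_scheme \<Rightarrow> dirs \<Rightarrow> ('r, 'm, 'v, 'w) mrep \<Rightarrow>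
   ('m, 'v, 'w, ('m \<Rightarrow> 'r) \<Rightarrow> 'r, 'v, ('w \<Rightarrow> 'r) \<Rightarrow> 'r) arrows" where
  "eta_bullet R \<sigma> \<theta> =
     (Fwd (eval_map R (modM \<theta>)), arrow_id (fst (snd \<sigma>)) (modV \<theta>), Fwd (eval_map R (modW \<theta>)))"

definition eta_vee ::
  "('r, 'z) ring_scheme \<Rightarrow> dirs \<Rightarrow> ('r, 'm, 'v, 'w) mrep \<Rightarrow>
   ('m, 'v, 'w, 'm, ('v \<Rightarrow> 'r) \<Rightarrow> 'r, ('w \<Rightarrow> 'r) \<Rightarrow> 'r) arrows" where
  "eta_vee R \<sigma> \<theta> =
     (arrow_id (fst \<sigma>) (modM \<theta>), Fwd (eval_map R (modV \<theta>)), Fwd (eval_map R (modW \<theta>)))"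

end

theory Submission
  imports Defs
begin

text \<open>
  The strings with their various conditions on triples of maps all describe one and the same thing.
  Replace each component of a morphism, whatever its direction, by its graph, a set of pairs
  \<open>(x, x')\<close> with \<open>x\<close> from the untilded and \<open>x'\<close> from the tilded module. Then the condition for
  every one of the eight strings reads: if \<open>a\<close> is related to \<open>a'\<close> and \<open>x\<close> to \<open>x'\<close>, then the product
  \<open>x * a\<close> is related to \<open>x' * a'\<close> (lemma \<open>mrep_hom_iff_graph\<close>). This form is visibly symmetric under
  exchanging the two representations, which accounts for the passage from a string to its opposite,
  and visibly symmetric in \<open>M\<close> and \<open>V\<close>, which accounts for \<open>\<theta>\<^sup>\<circ>\<close>.

  Duality fits in because a pair \<open>(\<chi>, \<chi>')\<close> of functionals belongs to the graph of a dual map precisely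
  when \<open>\<chi>\<close> and \<open>\<chi>'\<close> agree on all related pairs (lemma \<open>arrow_dual_graph\<close>), again without regard to
  the direction. Hence the bullet operation sends morphisms to morphisms: if \<open>\<chi>\<close> and \<open>\<chi>'\<close> agree on
  pairs related in \<open>W\<close>, and products of related elements are related in \<open>W\<close>, then the functionals
  \<open>a \<mapsto> \<chi> (x * a)\<close> and \<open>a' \<mapsto> \<chi>' (x' * a')\<close> agree on pairs related in \<open>M\<close> (lemma \<open>bullet_mor_hom\<close>).
  The third operation requires no argument of its own, as \<open>\<theta>\<^sup>\<or>\<close> is obtained from \<open>\<theta>\<close> by
  applying circle, bullet and circle in succession (lemma \<open>vee_eq\<close>). Each of the
  three operations therefore defines a functor on each of the eight categories, with values in one
  of the eight, and the functors in the statement are cases of these.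

  The laws for identities and composition, and the naturality squares, hold component by component:
  they say that dualization is a contravariant functor and that \<open>\<epsilon>\<close> is natural. That the triples
  \<open>\<eta>\<close> are morphisms comes down to \<open>\<chi> (x * a)\<close> being the value both of \<open>\<epsilon>\<^sub>M a\<close> at
  the functional \<open>x * \<chi>\<close> and of \<open>\<epsilon>\<^sub>W (x * a)\<close> at \<open>\<chi>\<close> (lemma \<open>eta_bullet_hom\<close>). For a string with
  down-arrows at the positions of the evaluation maps, the transformation is the one for the
  opposite string read backwards (lemma \<open>nat_trans_rev\<close>).
\<close>

section \<open>Linear maps and bilinear maps\<close>

lemma module_add_closed:
  "module R A \<Longrightarrow> x \<in> carrier A \<Longrightarrow> y \<in> carrier A \<Longrightarrow> x \<oplus>\<^bsub>A\<^esub> y \<in> carrier A"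
  by (meson abelian_groupE(1) module.axioms(2))

lemma mod_hom_closed: "f \<in> mod_hom R A B \<Longrightarrow> x \<in> carrier A \<Longrightarrow> f x \<in> carrier B"
  by (auto simp: mod_hom_def)

lemma mod_hom_add:
  "f \<in> mod_hom R A B \<Longrightarrow> x \<in> carrier A \<Longrightarrow> y \<in> carrier A \<Longrightarrow> f (x \<oplus>\<^bsub>A\<^esub> y) = f x \<oplus>\<^bsub>B\<^esub> f y"
  by (auto simp: mod_hom_def)

lemma mod_hom_smult:
  "f \<in> mod_hom R A B \<Longrightarrow> r \<in> carrier R \<Longrightarrow> x \<in> carrier A \<Longrightarrow> f (r \<odot>\<^bsub>A\<^esub> x) = r \<odot>\<^bsub>B\<^esub> f x"
  by (auto simp: mod_hom_def)

lemma mod_hom_extensional: "f \<in> mod_hom R A B \<Longrightarrow> f \<in> extensional (carrier A)"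
  by (auto simp: mod_hom_def PiE_def)

lemma mod_hom_restrict: "f \<in> mod_hom R A B \<Longrightarrow> (\<lambda>x\<in>carrier A. f x) = f"
  by (simp add: mod_hom_extensional extensional_restrict)

lemma mod_homI:
  assumes "module R A"
    and "\<And>x. x \<in> carrier A \<Longrightarrow> g x \<in> carrier B"
    and "\<And>x y. x \<in> carrier A \<Longrightarrow> y \<in> carrier A \<Longrightarrow> g (x \<oplus>\<^bsub>A\<^esub> y) = g x \<oplus>\<^bsub>B\<^esub> g y"
    and "\<And>r x. r \<in> carrier R \<Longrightarrow> x \<in> carrier A \<Longrightarrow> g (r \<odot>\<^bsub>A\<^esub> x) = r \<odot>\<^bsub>B\<^esub> g x"
  shows "(\<lambda>x\<in>carrier A. g x) \<in> mod_hom R A B"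
  using assms by (simp add: mod_hom_def module_add_closed module.smult_closed)

lemma mod_hom_id: "module R A \<Longrightarrow> (\<lambda>x\<in>carrier A. x) \<in> mod_hom R A A"
  by (rule mod_homI) auto

lemma hom_module_carrier: "carrier (hom_module R A B) = mod_hom R A B"
  by (simp add: hom_module_def)

lemma hom_module_add:
  "x \<in> carrier A \<Longrightarrow> (f \<oplus>\<^bsub>hom_module R A B\<^esub> g) x = f x \<oplus>\<^bsub>B\<^esub> g x"
  by (simp add: hom_module_def)

lemma hom_module_smult:
  "x \<in> carrier A \<Longrightarrow> (r \<odot>\<^bsub>hom_module R A B\<^esub> f) x = r \<odot>\<^bsub>B\<^esub> f x"
  by (simp add: hom_module_def)

text \<open>
  A homomorphism into a Hom module is a bilinear map in curried form.
\<close>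

lemma mod_hom_hom_moduleI:
  assumes "module R M" "module R V"
    and "\<And>a x. a \<in> carrier M \<Longrightarrow> x \<in> carrier V \<Longrightarrow> g a x \<in> carrier W"
    and "\<And>a b x. a \<in> carrier M \<Longrightarrow> b \<in> carrier M \<Longrightarrow> x \<in> carrier V \<Longrightarrow>
      g (a \<oplus>\<^bsub>M\<^esub> b) x = g a x \<oplus>\<^bsub>W\<^esub> g b x"
    and "\<And>r a x. r \<in> carrier R \<Longrightarrow> a \<in> carrier M \<Longrightarrow> x \<in> carrier V \<Longrightarrow>
      g (r \<odot>\<^bsub>M\<^esub> a) x = r \<odot>\<^bsub>W\<^esub> g a x"
    and "\<And>a x y. a \<in> carrier M \<Longrightarrow> x \<in> carrier V \<Longrightarrow> y \<in> carrier V \<Longrightarrow>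
      g a (x \<oplus>\<^bsub>V\<^esub> y) = g a x \<oplus>\<^bsub>W\<^esub> g a y"
    and "\<And>r a x. r \<in> carrier R \<Longrightarrow> a \<in> carrier M \<Longrightarrow> x \<in> carrier V \<Longrightarrow>
      g a (r \<odot>\<^bsub>V\<^esub> x) = r \<odot>\<^bsub>W\<^esub> g a x"
  shows "(\<lambda>a\<in>carrier M. \<lambda>x\<in>carrier V. g a x) \<in> mod_hom R M (hom_module R V W)"
proof (rule mod_homI)
  fix a assume "a \<in> carrier M"
  then show "(\<lambda>x\<in>carrier V. g a x) \<in> carrier (hom_module R V W)"
    unfolding hom_module_carrier using assms by (intro mod_homI) auto
qed (use assms in \<open>auto simp: hom_module_def module_add_closed module.smult_closed intro!: restrict_ext\<close>)

lemma mod_hom_hom_moduleD: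
  assumes "f \<in> mod_hom R M (hom_module R V W)" "a \<in> carrier M"
  shows "f a \<in> mod_hom R V W"
  using mod_hom_closed[OF assms] by (simp add: hom_module_carrier)

lemma mod_hom_hom_module_left:
  assumes f: "f \<in> mod_hom R M (hom_module R V W)" and "x \<in> carrier V" "a \<in> carrier M"
  shows "b \<in> carrier M \<Longrightarrow> f (a \<oplus>\<^bsub>M\<^esub> b) x = f a x \<oplus>\<^bsub>W\<^esub> f b x"
    and "r \<in> carrier R \<Longrightarrow> f (r \<odot>\<^bsub>M\<^esub> a) x = r \<odot>\<^bsub>W\<^esub> f a x"
  using assms by (simp_all add: mod_hom_add[OF f] mod_hom_smult[OF f] hom_module_add hom_module_smult)

text \<open>
  The currying of a bilinear map in the other order; it is what makes \<open>\<theta>\<^sup>\<circ>\<close> a module representation, and it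
  yields the evaluation map from the identity of the dual.
\<close>

lemma mod_hom_swap:
  assumes "module R M" "module R V" and f: "f \<in> mod_hom R M (hom_module R V W)"
  shows "(\<lambda>x\<in>carrier V. \<lambda>a\<in>carrier M. f a x) \<in> mod_hom R V (hom_module R M W)"
  using assms(1,2)
  by (intro mod_hom_hom_moduleI)
    (auto simp: mod_hom_hom_module_left[OF f] mod_hom_closed[OF mod_hom_hom_moduleD[OF f]]
      mod_hom_add[OF mod_hom_hom_moduleD[OF f]] mod_hom_smult[OF mod_hom_hom_moduleD[OF f]])

lemma hom_module_module:
  assumes A: "module R A" and B: "module R B"
  shows "module R (hom_module R A B)"
proof -
  interpret A: module R A by fact
  interpret B: module R B by fact
  note hom = mod_hom_closed mod_hom_add mod_hom_smult
  have zero: "(\<lambda>x\<in>carrier A. \<zero>\<^bsub>B\<^esub>) \<in> mod_hom R A B"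
    by (rule mod_homI) (auto simp: A)
  have add: "(\<lambda>x\<in>carrier A. f x \<oplus>\<^bsub>B\<^esub> g x) \<in> mod_hom R A B"
    if "f \<in> mod_hom R A B" "g \<in> mod_hom R A B" for f g
    using that by (intro mod_homI) (auto simp: A hom B.a_ac B.smult_r_distr)
  \<comment> \<open>A scalar multiple of a homomorphism is linear because \<open>R\<close> is commutative.\<close>
  have smult: "(\<lambda>x\<in>carrier A. r \<odot>\<^bsub>B\<^esub> f x) \<in> mod_hom R A B"
    if "r \<in> carrier R" "f \<in> mod_hom R A B" for r f
    using that by (intro mod_homI)
      (auto simp: A hom B.smult_r_distr B.smult_assoc1[symmetric] A.m_comm)
  have minus: "(\<lambda>x\<in>carrier A. \<ominus>\<^bsub>B\<^esub> f x) \<in> mod_hom R A B" if "f \<in> mod_hom R A B" for f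
    using that by (intro mod_homI) (auto simp: A hom B.minus_add B.smult_r_minus)
  have ext: "f = g" if "f \<in> mod_hom R A B" "g \<in> mod_hom R A B" "\<And>x. x \<in> carrier A \<Longrightarrow> f x = g x"
    for f g
    using that by (meson extensionalityI mod_hom_extensional)
  show ?thesis
  proof (rule moduleI)
    show "abelian_group (hom_module R A B)"
    proof (rule abelian_groupI)
      fix f assume "f \<in> carrier (hom_module R A B)"
      then have f: "f \<in> mod_hom R A B"
        by (simp add: hom_module_carrier)
      show "\<exists>g\<in>carrier (hom_module R A B). g \<oplus>\<^bsub>hom_module R A B\<^esub> f = \<zero>\<^bsub>hom_module R A B\<^esub>"
        using minus[OF f]
        by (intro bexI[of _ "\<lambda>x\<in>carrier A. \<ominus>\<^bsub>B\<^esub> f x"])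
          (auto simp: hom_module_def B.l_neg mod_hom_closed[OF f] intro!: restrict_ext)
      show "\<zero>\<^bsub>hom_module R A B\<^esub> \<oplus>\<^bsub>hom_module R A B\<^esub> f = f"
        using f add[OF zero f]
        by (intro ext) (auto simp: hom_module_def mod_hom_closed cong: restrict_cong)
    qed (auto simp: hom_module_def zero add mod_hom_closed B.a_ac intro!: restrict_ext)
  next
    fix f assume "f \<in> carrier (hom_module R A B)"
    then have f: "f \<in> mod_hom R A B"
      by (simp add: hom_module_carrier)
    show "\<one>\<^bsub>R\<^esub> \<odot>\<^bsub>hom_module R A B\<^esub> f = f"
      using f by (intro ext) (auto simp: hom_module_def smult mod_hom_closed)
  qed (auto simp: hom_module_def smult add mod_hom_closed A.is_cring
      B.smult_l_distr B.smult_r_distr B.smult_assoc1 intro!: restrict_ext)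
qed

section \<open>Duals and evaluation maps\<close>

lemma self_module_module: "cring R \<Longrightarrow> module R (self_module R)"
proof -
  assume "cring R"
  then interpret cring R .
  show ?thesis
  proof (rule moduleI)
    show "abelian_group (self_module R)"
      by (rule abelian_groupI) (auto simp: self_module_def a_ac intro: l_neg a_inv_closed)
  qed (auto simp: self_module_def is_cring l_distr r_distr m_assoc)
qed

lemma dual_module_module: "module R U \<Longrightarrow> module R (dual_module R U)"
  unfolding dual_module_def by (meson hom_module_module self_module_module module.axioms(1))

lemma dual_module_carrier: "carrier (dual_module R U) = mod_hom R U (self_module R)"
  by (simp add: dual_module_def hom_module_carrier)

lemma dual_module_add:
  "f \<oplus>\<^bsub>dual_module R U\<^esub> g = (\<lambda>x\<in>carrier U. f x \<oplus>\<^bsub>self_module R\<^esub> g x)"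
  by (simp add: dual_module_def hom_module_def)

lemma dual_module_smult:
  "r \<odot>\<^bsub>dual_module R U\<^esub> f = (\<lambda>x\<in>carrier U. r \<odot>\<^bsub>self_module R\<^esub> f x)"
  by (simp add: dual_module_def hom_module_def)

lemma dual_module_eqI:
  assumes "\<phi> \<in> carrier (dual_module R U)" "\<chi> \<in> carrier (dual_module R U)"
    and "\<And>u. u \<in> carrier U \<Longrightarrow> \<phi> u = \<chi> u"
  shows "\<phi> = \<chi>"
  using assms unfolding dual_module_carrier by (meson extensionalityI mod_hom_extensional)

lemma dual_module_pullback:
  assumes "module R A" "f \<in> mod_hom R A B" "\<chi> \<in> carrier (dual_module R B)"
  shows "(\<lambda>x\<in>carrier A. \<chi> (f x)) \<in> carrier (dual_module R A)"
  using assms unfolding dual_module_carrier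
  by (intro mod_homI) (auto simp: mod_hom_closed mod_hom_add mod_hom_smult)

lemma dual_map_mod_hom:
  assumes "module R A" "module R B" "f \<in> mod_hom R A B"
  shows "dual_map R A B f \<in> mod_hom R (dual_module R B) (dual_module R A)"
  unfolding dual_map_def dual_module_def[of R A]
  using assms
  by (intro mod_hom_hom_moduleI)
    (auto simp: dual_module_module dual_module_add dual_module_smult dual_module_carrier
      mod_hom_closed mod_hom_add mod_hom_smult)

lemma dual_map_apply:
  "\<chi> \<in> carrier (dual_module R B) \<Longrightarrow> x \<in> carrier A \<Longrightarrow> dual_map R A B f \<chi> x = \<chi> (f x)"
  by (simp add: dual_map_def)

lemma dual_map_id:
  "dual_map R A A (\<lambda>x\<in>carrier A. x) = (\<lambda>\<chi>\<in>carrier (dual_module R A). \<chi>)"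
proof (unfold dual_map_def, rule restrict_ext)
  fix \<chi> assume "\<chi> \<in> carrier (dual_module R A)"
  then have "(\<lambda>x\<in>carrier A. \<chi> x) = \<chi>"
    by (simp add: dual_module_carrier mod_hom_restrict)
  then show "(\<lambda>x\<in>carrier A. \<chi> ((\<lambda>x\<in>carrier A. x) x)) = \<chi>"
    by (simp cong: restrict_cong)
qed

lemma dual_map_compose:
  assumes "module R B" "f \<in> mod_hom R A B" "g \<in> mod_hom R B C"
  shows "dual_map R A C (compose (carrier A) g f) =
    compose (carrier (dual_module R C)) (dual_map R A B f) (dual_map R B C g)"
  using assms
  by (auto simp: dual_map_def compose_def dual_module_pullback mod_hom_closed intro!: restrict_ext)

lemma eval_map_apply:
  "u \<in> carrier U \<Longrightarrow> \<chi> \<in> carrier (dual_module R U) \<Longrightarrow> eval_map R U u \<chi> = \<chi> u"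
  by (simp add: eval_map_def)

lemma eval_map_mod_hom:
  assumes "module R U"
  shows "eval_map R U \<in> mod_hom R U (dual_module R (dual_module R U))"
proof -
  \<comment> \<open>The identity of \<open>U\<^sup>*\<close> is the canonical pairing of \<open>U\<^sup>*\<close> and \<open>U\<close>, curried at \<open>U\<^sup>*\<close>.\<close>
  have "(\<lambda>\<chi>\<in>carrier (dual_module R U). \<chi>) \<in>
      mod_hom R (dual_module R U) (hom_module R U (self_module R))"
    using mod_hom_id[OF dual_module_module[OF assms]] by (simp add: dual_module_def)
  from mod_hom_swap[OF dual_module_module[OF assms] assms this]
  have "(\<lambda>u\<in>carrier U. \<lambda>\<chi>\<in>carrier (dual_module R U). \<chi> u) \<in>
      mod_hom R U (hom_module R (dual_module R U) (self_module R))"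
    by (simp cong: restrict_cong)
  then show ?thesis
    by (simp add: eval_map_def dual_module_def[of R "dual_module R U"])
qed

lemma eval_map_natural:
  assumes "module R A" "module R B" and f: "f \<in> mod_hom R A B"
  shows "compose (carrier A) (eval_map R B) f =
    compose (carrier A) (dual_map R (dual_module R B) (dual_module R A) (dual_map R A B f))
      (eval_map R A)"
proof (unfold compose_def, rule restrict_ext)
  fix x assume x: "x \<in> carrier A"
  have eval: "eval_map R A x \<in> carrier (dual_module R (dual_module R A))"
    by (rule mod_hom_closed[OF eval_map_mod_hom[OF assms(1)] x])
  show "eval_map R B (f x) =
    dual_map R (dual_module R B) (dual_module R A) (dual_map R A B f) (eval_map R A x)"
    using x mod_hom_closed[OF f x] mod_hom_closed[OF dual_map_mod_hom[OF assms]]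
    by (intro dual_module_eqI[OF mod_hom_closed[OF eval_map_mod_hom]]
        mod_hom_closed[OF dual_map_mod_hom[OF _ _ dual_map_mod_hom]])
      (auto simp: assms eval dual_module_module dual_map_apply eval_map_apply)
qed

section \<open>Arrows and their graphs\<close>

lemma opp_opp: "opp (opp d) = d"
  by (cases d) auto

lemma arrow_homE:
  assumes "p \<in> arrow_hom R d A B"
  obtains (up) f where "d = \<up>" "p = Fwd f" "f \<in> mod_hom R A B"
    | (down) g where "d = \<down>" "p = Bwd g" "g \<in> mod_hom R B A"
  using assms by (cases d) auto

text \<open>
  The pairs are ordered from the source \<open>A\<close> to the target \<open>B\<close> of the arrow, so that the graph of a
  backward arrow is the converse of the graph of the map it carries.
\<close>

fun arrow_graph :: "('r, 'a) module \<Rightarrow> ('r, 'b) module \<Rightarrow> ('a, 'b) arrow \<Rightarrow> ('a \<times> 'b) set" where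
  "arrow_graph A B (Fwd f) = {(x, y). x \<in> carrier A \<and> y = f x}"
| "arrow_graph A B (Bwd g) = {(x, y). y \<in> carrier B \<and> x = g y}"

lemma arrow_graph_carrier:
  assumes "p \<in> arrow_hom R d A B" "(x, y) \<in> arrow_graph A B p"
  shows "x \<in> carrier A" "y \<in> carrier B"
  using assms by (auto elim!: arrow_homE intro: mod_hom_closed)

lemma arrow_graph_rev: "arrow_graph B A (arrow_rev p) = (arrow_graph A B p)\<inverse>"
  by (cases p) auto

lemma arrow_graph_id: "arrow_graph A A (arrow_id d A) = Id_on (carrier A)"
  by (cases d) auto

lemma arrow_rev_rev: "arrow_rev (arrow_rev p) = p"
  by (cases p) auto

lemma arrow_rev_hom_iff: "arrow_rev p \<in> arrow_hom R (opp d) B A \<longleftrightarrow> p \<in> arrow_hom R d A B"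
  by (cases p; cases d) auto

lemma arrow_id_hom: "module R A \<Longrightarrow> arrow_id d A \<in> arrow_hom R d A A"
  by (cases d) (auto intro: mod_hom_id)

lemma arrow_comp_id:
  assumes "p \<in> arrow_hom R d A B"
  shows "arrow_comp A B (arrow_id d A) p = p" "arrow_comp A B p (arrow_id d B) = p"
  using assms
  by (auto elim!: arrow_homE simp: compose_def mod_hom_closed mod_hom_restrict cong: restrict_cong)

lemma arrow_comp_rev:
  assumes "p \<in> arrow_hom R d A B" "q \<in> arrow_hom R d B C"
  shows "arrow_rev (arrow_comp A C p q) = arrow_comp C A (arrow_rev q) (arrow_rev p)"
  using assms by (auto elim!: arrow_homE)

lemma arrow_dual_hom:
  assumes "module R A" "module R B" "p \<in> arrow_hom R d A B"
  shows "arrow_dual R A B p \<in> arrow_hom R (opp d) (dual_module R A) (dual_module R B)"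
  using assms by (auto elim!: arrow_homE intro!: imageI dual_map_mod_hom)

lemma arrow_dual_rev: "arrow_dual R B A (arrow_rev p) = arrow_rev (arrow_dual R A B p)"
  by (cases p) auto

lemma arrow_dual_id: "arrow_dual R A A (arrow_id d A) = arrow_id (opp d) (dual_module R A)"
  by (cases d) (auto simp: dual_map_id)

lemma arrow_dual_comp:
  assumes "module R B" "p \<in> arrow_hom R d A B" "q \<in> arrow_hom R d B C"
  shows "arrow_dual R A C (arrow_comp A C p q) =
    arrow_comp (dual_module R A) (dual_module R C) (arrow_dual R A B p) (arrow_dual R B C q)"
  using assms by (auto elim!: arrow_homE simp: dual_map_compose)

text \<open>
  A functional in the image of a dual map is determined by its values, so being related by the dual
  arrow amounts to agreement on related elements. As this does not mention the direction of the
  arrow, it removes all case distinctions on strings from what follows.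
\<close>

lemma arrow_dual_graph:
  assumes "module R A" "module R B" "p \<in> arrow_hom R d A B"
  shows "(\<chi>, \<chi>') \<in> arrow_graph (dual_module R A) (dual_module R B) (arrow_dual R A B p) \<longleftrightarrow>
    \<chi> \<in> carrier (dual_module R A) \<and> \<chi>' \<in> carrier (dual_module R B) \<and>
    (\<forall>(x, x') \<in> arrow_graph A B p. \<chi> x = \<chi>' x')"
  using assms(3)
proof (cases rule: arrow_homE)
  case (up f)
  have "\<chi> = dual_map R A B f \<chi>' \<longleftrightarrow>
      \<chi> \<in> carrier (dual_module R A) \<and> (\<forall>x\<in>carrier A. \<chi> x = \<chi>' (f x))"
    if "\<chi>' \<in> carrier (dual_module R B)"
    using that mod_hom_closed[OF dual_map_mod_hom[OF assms(1,2) up(3)] that]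
    by (auto simp: dual_map_apply intro: dual_module_eqI)
  with up show ?thesis by auto
next
  case (down g)
  have "\<chi>' = dual_map R B A g \<chi> \<longleftrightarrow>
      \<chi>' \<in> carrier (dual_module R B) \<and> (\<forall>x\<in>carrier B. \<chi> (g x) = \<chi>' x)"
    if "\<chi> \<in> carrier (dual_module R A)"
    using that mod_hom_closed[OF dual_map_mod_hom[OF assms(2,1) down(3)] that]
    by (auto simp: dual_map_apply intro: dual_module_eqI)
  with down show ?thesis by auto
qed

section \<open>Morphisms as graphs compatible with the multiplications\<close>

lemma module_repD:
  assumes "module_rep R \<theta>"
  shows "module R (modM \<theta>)" "module R (modV \<theta>)" "module R (modW \<theta>)"
    "rep \<theta> \<in> mod_hom R (modM \<theta>) (hom_module R (modV \<theta>) (modW \<theta>))"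
    "a \<in> carrier (modM \<theta>) \<Longrightarrow> rep \<theta> a \<in> mod_hom R (modV \<theta>) (modW \<theta>)"
    "a \<in> carrier (modM \<theta>) \<Longrightarrow> x \<in> carrier (modV \<theta>) \<Longrightarrow> rep \<theta> a x \<in> carrier (modW \<theta>)"
  using assms mod_hom_hom_moduleD[of "rep \<theta>"] mod_hom_closed[OF mod_hom_hom_moduleD[of "rep \<theta>"]]
  by (auto simp: module_rep_def)

text \<open>
  Each of the four defining conditions quantifies over the sources of the maps for \<open>M\<close> and \<open>V\<close>, that
  is, over the pairs in their graphs, and equates what the map for \<open>W\<close> makes of one product with the
  other product. For the remaining four strings it is the converse graphs that enter, with
  the two representations exchanged, which yields the same condition.
\<close>

lemma mrep_hom_iff_graph:
  assumes "module_rep R \<theta>" "module_rep R \<theta>'"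
  shows "(p, q, s) \<in> mrep_hom R (d, e, h) \<theta> \<theta>' \<longleftrightarrow>
    p \<in> arrow_hom R d (modM \<theta>) (modM \<theta>') \<and>
    q \<in> arrow_hom R e (modV \<theta>) (modV \<theta>') \<and>
    s \<in> arrow_hom R h (modW \<theta>) (modW \<theta>') \<and>
    (\<forall>(a, a') \<in> arrow_graph (modM \<theta>) (modM \<theta>') p. \<forall>(x, x') \<in> arrow_graph (modV \<theta>) (modV \<theta>') q.
      (rep \<theta> a x, rep \<theta>' a' x') \<in> arrow_graph (modW \<theta>) (modW \<theta>') s)"
  (is "?hom \<longleftrightarrow> ?arrows")
proof -
  \<comment> \<open>For given directions at most one of the two alternatives is satisfiable: \<open>compat\<close> is false on
      triples tagged by a string outside the basic four.\<close>
  have "?hom \<longleftrightarrow> p \<in> arrow_hom R d (modM \<theta>) (modM \<theta>') \<and>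
      q \<in> arrow_hom R e (modV \<theta>) (modV \<theta>') \<and>
      s \<in> arrow_hom R h (modW \<theta>) (modW \<theta>') \<and>
      (compat \<theta> \<theta>' (p, q, s) \<or> compat \<theta>' \<theta> (arrows_rev (p, q, s)))"
    by (cases d; cases e; cases h; cases p; cases q; cases s)
      (auto simp: mrep_hom_def basic_dirs_def basic_hom_def)
  also have "\<dots> \<longleftrightarrow> ?arrows"
    by (cases p; cases q; cases s; cases d; cases e; cases h)
      (auto simp: mrep_mult_def module_repD[OF assms(1)] module_repD[OF assms(2)] mod_hom_closed)
  finally show ?thesis .
qed

lemma mrep_homE:
  assumes "t \<in> mrep_hom R (d, e, h) \<theta> \<theta>'" "module_rep R \<theta>" "module_rep R \<theta>'"
  obtains p q s where "t = (p, q, s)" "p \<in> arrow_hom R d (modM \<theta>) (modM \<theta>')"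
    "q \<in> arrow_hom R e (modV \<theta>) (modV \<theta>')" "s \<in> arrow_hom R h (modW \<theta>) (modW \<theta>')"
  using assms by (cases t) (auto simp: mrep_hom_iff_graph)

lemma arrows_rev_rev: "arrows_rev (arrows_rev t) = t"
  by (cases t) (auto simp: arrow_rev_rev)

lemma arrows_rev_hom:
  assumes "module_rep R \<theta>" "module_rep R \<theta>'" "t \<in> mrep_hom R \<sigma> \<theta> \<theta>'"
  shows "arrows_rev t \<in> mrep_hom R (bar \<sigma>) \<theta>' \<theta>"
  using assms
  by (cases t; cases \<sigma>) (auto simp: mrep_hom_iff_graph arrow_rev_hom_iff arrow_graph_rev; fastforce)

lemma mrep_id_hom:
  assumes "module_rep R \<theta>"
  shows "mrep_id \<sigma> \<theta> \<in> mrep_hom R \<sigma> \<theta> \<theta>"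
  using assms
  by (cases \<sigma>) (auto simp: mrep_hom_iff_graph arrow_graph_id module_repD arrow_id_hom)

lemma mrep_comp_id:
  assumes "module_rep R \<theta>" "module_rep R \<theta>'" "t \<in> mrep_hom R \<sigma> \<theta> \<theta>'"
  shows "mrep_comp \<theta> \<theta>' (mrep_id \<sigma> \<theta>) t = t" "mrep_comp \<theta> \<theta>' t (mrep_id \<sigma> \<theta>') = t"
  using assms by (cases \<sigma>; auto elim!: mrep_homE simp: arrow_comp_id)+

lemma mrep_comp_rev:
  assumes "module_rep R \<theta>1" "module_rep R \<theta>2" "module_rep R \<theta>3"
    and "t \<in> mrep_hom R \<sigma> \<theta>1 \<theta>2" "u \<in> mrep_hom R \<sigma> \<theta>2 \<theta>3"
  shows "arrows_rev (mrep_comp \<theta>1 \<theta>3 t u) = mrep_comp \<theta>3 \<theta>1 (arrows_rev u) (arrows_rev t)"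
  using assms by (cases \<sigma>) (auto elim!: mrep_homE simp: arrow_comp_rev)

section \<open>The operations on representations\<close>

lemma circ_simps:
  "modM (circ \<theta>) = modV \<theta>" "modV (circ \<theta>) = modM \<theta>" "modW (circ \<theta>) = modW \<theta>"
  "x \<in> carrier (modV \<theta>) \<Longrightarrow> a \<in> carrier (modM \<theta>) \<Longrightarrow> rep (circ \<theta>) x a = rep \<theta> a x"
  by (simp_all add: circ_def)

lemma bullet_simps:
  "modM (bullet R \<theta>) = dual_module R (modW \<theta>)" "modV (bullet R \<theta>) = modV \<theta>"
  "modW (bullet R \<theta>) = dual_module R (modM \<theta>)"
  "\<psi> \<in> carrier (dual_module R (modW \<theta>)) \<Longrightarrow> x \<in> carrier (modV \<theta>) \<Longrightarrow> a \<in> carrier (modM \<theta>) \<Longrightarrow>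
    rep (bullet R \<theta>) \<psi> x a = \<psi> (rep \<theta> a x)"
  by (simp_all add: bullet_def)

lemma module_rep_circ:
  assumes "module_rep R \<theta>"
  shows "module_rep R (circ \<theta>)"
  using assms by (auto simp: module_rep_def circ_def intro: mod_hom_swap)

lemma circ_circ:
  assumes "module_rep R \<theta>"
  shows "circ (circ \<theta>) = \<theta>"
proof -
  have "(\<lambda>a\<in>carrier (modM \<theta>). \<lambda>x\<in>carrier (modV \<theta>). rep \<theta> a x) =
      (\<lambda>a\<in>carrier (modM \<theta>). rep \<theta> a)"
    by (intro restrict_ext mod_hom_restrict[OF module_repD(5)[OF assms]])
  also have "\<dots> = rep \<theta>"
    by (rule mod_hom_restrict[OF module_repD(4)[OF assms]])
  finally have "(\<lambda>a\<in>carrier (modM \<theta>). \<lambda>x\<in>carrier (modV \<theta>). rep \<theta> a x) = rep \<theta>" .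
  then show ?thesis
    by (cases \<theta>) (simp add: circ_def cong: restrict_cong)
qed

lemma module_rep_bullet:
  assumes \<theta>: "module_rep R \<theta>"
  shows "module_rep R (bullet R \<theta>)"
proof -
  note mods = module_repD(1-3)[OF \<theta>]
  note closed = module_repD(6)[OF \<theta>]
  have "(\<lambda>a\<in>carrier (modM \<theta>). \<psi> (rep \<theta> a x)) \<in> carrier (dual_module R (modM \<theta>))"
    if "\<psi> \<in> carrier (dual_module R (modW \<theta>))" "x \<in> carrier (modV \<theta>)" for \<psi> x
  proof -
    have "(\<lambda>a\<in>carrier (modM \<theta>). rep \<theta> a x) \<in> mod_hom R (modM \<theta>) (modW \<theta>)"
      using module_repD(5)[OF module_rep_circ[OF \<theta>], of x] that(2)
      by (simp add: circ_def)
    from dual_module_pullback[OF mods(1) this that(1)] show ?thesis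
      by (simp cong: restrict_cong)
  qed
  then have "(\<lambda>\<psi>\<in>carrier (dual_module R (modW \<theta>)). \<lambda>x\<in>carrier (modV \<theta>).
      \<lambda>a\<in>carrier (modM \<theta>). \<psi> (rep \<theta> a x)) \<in>
    mod_hom R (dual_module R (modW \<theta>)) (hom_module R (modV \<theta>) (dual_module R (modM \<theta>)))"
    using mods closed
    by (intro mod_hom_hom_moduleI)
      (auto simp: dual_module_module dual_module_add dual_module_smult dual_module_carrier
        mod_hom_add[OF module_repD(5)[OF \<theta>]] mod_hom_smult[OF module_repD(5)[OF \<theta>]]
        mod_hom_add mod_hom_smult intro!: restrict_ext)
  then show ?thesis
    by (simp add: module_rep_def bullet_def mods dual_module_module)
qed

text \<open>
  Both sides turn the trilinear form \<open>\<psi> (x * a)\<close> into nested functions of \<open>a\<close>, \<open>\<psi>\<close> and \<open>x\<close>, in this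
  order. The circle operation exchanges the first two arguments and the bullet operation takes
  \<open>\<psi>\<close> to the front while moving the module \<open>M\<close> of its argument to the end.
\<close>

lemma vee_eq: "vee R \<theta> = circ (bullet R (circ \<theta>))"
  by (simp add: vee_def bullet_def circ_def cong: restrict_cong)

lemma vee_mor_eq:
  "vee_mor R \<theta> \<theta>' t =
    circ_mor (bullet R (circ \<theta>)) (bullet R (circ \<theta>')) (bullet_mor R (circ \<theta>) (circ \<theta>') (circ_mor \<theta> \<theta>' t))"
  by (cases t) (simp add: circ_simps)

lemma vee_simps:
  "modM (vee R \<theta>) = modM \<theta>" "modV (vee R \<theta>) = dual_module R (modW \<theta>)"
  "modW (vee R \<theta>) = dual_module R (modV \<theta>)"
  by (simp_all add: vee_def)

lemma module_rep_vee: "module_rep R \<theta> \<Longrightarrow> module_rep R (vee R \<theta>)"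
  by (simp add: vee_eq module_rep_circ module_rep_bullet)

section \<open>Functoriality\<close>

lemma circ_mor_hom:
  assumes "module_rep R \<theta>" "module_rep R \<theta>'" "t \<in> mrep_hom R (d, e, h) \<theta> \<theta>'"
  shows "circ_mor \<theta> \<theta>' t \<in> mrep_hom R (e, d, h) (circ \<theta>) (circ \<theta>')"
proof -
  obtain p q s where t: "t = (p, q, s)"
    by (cases t)
  note hom = assms(3)[unfolded t mrep_hom_iff_graph[OF assms(1,2)]]
  have "(rep (circ \<theta>) x a, rep (circ \<theta>') x' a') \<in> arrow_graph (modW \<theta>) (modW \<theta>') s"
    if a: "(a, a') \<in> arrow_graph (modM \<theta>) (modM \<theta>') p"
      and x: "(x, x') \<in> arrow_graph (modV \<theta>) (modV \<theta>') q" for a a' x x'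
  proof -
    have "a \<in> carrier (modM \<theta>)" "a' \<in> carrier (modM \<theta>')"
      and "x \<in> carrier (modV \<theta>)" "x' \<in> carrier (modV \<theta>')"
      using hom arrow_graph_carrier a x by metis+
    moreover have "(rep \<theta> a x, rep \<theta>' a' x') \<in> arrow_graph (modW \<theta>) (modW \<theta>') s"
      using hom a x by blast
    ultimately show ?thesis
      by (simp add: circ_simps)
  qed
  then show ?thesis
    unfolding t circ_mor.simps circ_simps(1-3)
      mrep_hom_iff_graph[OF module_rep_circ[OF assms(1)] module_rep_circ[OF assms(2)]]
    using hom by blast
qed

text \<open>
  If \<open>\<chi>\<close> and \<open>\<chi>'\<close> agree on related elements of \<open>W\<close>, then, products of related elements being related,
  \<open>\<chi> (x * a) = \<chi>' (x' * a')\<close> for related \<open>a\<close> and \<open>a'\<close>: the new products are related by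
  the dual of the map for \<open>M\<close>.
\<close>

lemma bullet_mor_hom:
  assumes \<theta>: "module_rep R \<theta>" and \<theta>': "module_rep R \<theta>'" and t: "t \<in> mrep_hom R (d, e, h) \<theta> \<theta>'"
  shows "bullet_mor R \<theta> \<theta>' t \<in> mrep_hom R (opp h, e, opp d) (bullet R \<theta>) (bullet R \<theta>')"
proof -
  note mods = module_repD(1-3)[OF \<theta>] module_repD(1-3)[OF \<theta>']
  obtain p q s where t_eq: "t = (p, q, s)"
    by (cases t)
  note hom = t[unfolded t_eq mrep_hom_iff_graph[OF \<theta> \<theta>']]
  have p: "p \<in> arrow_hom R d (modM \<theta>) (modM \<theta>')"
    and q: "q \<in> arrow_hom R e (modV \<theta>) (modV \<theta>')"
    and s: "s \<in> arrow_hom R h (modW \<theta>) (modW \<theta>')"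
    using hom by blast+
  have mult: "(rep \<theta> a x, rep \<theta>' a' x') \<in> arrow_graph (modW \<theta>) (modW \<theta>') s"
    if "(a, a') \<in> arrow_graph (modM \<theta>) (modM \<theta>') p"
      "(x, x') \<in> arrow_graph (modV \<theta>) (modV \<theta>') q" for a a' x x'
    using hom that by blast
  have "(rep (bullet R \<theta>) \<chi> x, rep (bullet R \<theta>') \<chi>' x') \<in>
      arrow_graph (dual_module R (modM \<theta>)) (dual_module R (modM \<theta>'))
        (arrow_dual R (modM \<theta>) (modM \<theta>') p)"
    if \<chi>: "(\<chi>, \<chi>') \<in> arrow_graph (dual_module R (modW \<theta>)) (dual_module R (modW \<theta>'))
        (arrow_dual R (modW \<theta>) (modW \<theta>') s)"
      and x: "(x, x') \<in> arrow_graph (modV \<theta>) (modV \<theta>') q" for \<chi> \<chi>' x x'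
  proof -
    note agree = \<chi>[unfolded arrow_dual_graph[OF mods(3,6) s]]
    have \<chi>_carrier: "\<chi> \<in> carrier (dual_module R (modW \<theta>))" "\<chi>' \<in> carrier (dual_module R (modW \<theta>'))"
      using agree by blast+
    have \<chi>_eq: "\<chi> w = \<chi>' w'" if "(w, w') \<in> arrow_graph (modW \<theta>) (modW \<theta>') s" for w w'
      using agree that by blast
    note x_carrier = arrow_graph_carrier[OF q x]
    have "rep (bullet R \<theta>) \<chi> x a = rep (bullet R \<theta>') \<chi>' x' a'"
      if a: "(a, a') \<in> arrow_graph (modM \<theta>) (modM \<theta>') p" for a a'
      using \<chi>_eq[OF mult[OF a x]]
      by (simp add: bullet_simps \<chi>_carrier x_carrier arrow_graph_carrier[OF p a])
    moreover have "rep (bullet R \<theta>) \<chi> x \<in> carrier (dual_module R (modM \<theta>))"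
      using module_repD(6)[OF module_rep_bullet[OF \<theta>], of \<chi> x] \<chi>_carrier x_carrier
      by (simp add: bullet_simps)
    moreover have "rep (bullet R \<theta>') \<chi>' x' \<in> carrier (dual_module R (modM \<theta>'))"
      using module_repD(6)[OF module_rep_bullet[OF \<theta>'], of \<chi>' x'] \<chi>_carrier x_carrier
      by (simp add: bullet_simps)
    ultimately show ?thesis
      unfolding arrow_dual_graph[OF mods(1,4) p] by blast
  qed
  then show ?thesis
    unfolding t_eq bullet_mor.simps
      mrep_hom_iff_graph[OF module_rep_bullet[OF \<theta>] module_rep_bullet[OF \<theta>']] bullet_simps(1-3)
    using arrow_dual_hom[OF mods(3,6) s] q arrow_dual_hom[OF mods(1,4) p] by blast
qed

lemma vee_mor_hom:
  assumes "module_rep R \<theta>" "module_rep R \<theta>'" "t \<in> mrep_hom R (d, e, h) \<theta> \<theta>'"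
  shows "vee_mor R \<theta> \<theta>' t \<in> mrep_hom R (d, opp h, opp e) (vee R \<theta>) (vee R \<theta>')"
  unfolding vee_eq vee_mor_eq
  using assms by (intro circ_mor_hom bullet_mor_hom module_rep_bullet module_rep_circ)

lemma circ_mor_comp:
  "circ_mor \<theta>1 \<theta>3 (mrep_comp \<theta>1 \<theta>3 t u) =
    mrep_comp (circ \<theta>1) (circ \<theta>3) (circ_mor \<theta>1 \<theta>2 t) (circ_mor \<theta>2 \<theta>3 u)"
  by (cases t; cases u) (simp add: circ_simps)

lemma bullet_mor_comp:
  assumes "module_rep R \<theta>1" "module_rep R \<theta>2" "module_rep R \<theta>3"
    and "t \<in> mrep_hom R \<sigma> \<theta>1 \<theta>2" "u \<in> mrep_hom R \<sigma> \<theta>2 \<theta>3"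
  shows "bullet_mor R \<theta>1 \<theta>3 (mrep_comp \<theta>1 \<theta>3 t u) =
    mrep_comp (bullet R \<theta>1) (bullet R \<theta>3) (bullet_mor R \<theta>1 \<theta>2 t) (bullet_mor R \<theta>2 \<theta>3 u)"
  using assms
  by (cases \<sigma>) (auto elim!: mrep_homE simp: bullet_simps module_repD arrow_dual_comp)

lemma vee_mor_comp:
  assumes "module_rep R \<theta>1" "module_rep R \<theta>2" "module_rep R \<theta>3"
    and "t \<in> mrep_hom R \<sigma> \<theta>1 \<theta>2" "u \<in> mrep_hom R \<sigma> \<theta>2 \<theta>3"
  shows "vee_mor R \<theta>1 \<theta>3 (mrep_comp \<theta>1 \<theta>3 t u) =
    mrep_comp (vee R \<theta>1) (vee R \<theta>3) (vee_mor R \<theta>1 \<theta>2 t) (vee_mor R \<theta>2 \<theta>3 u)"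
  using assms
  by (cases \<sigma>) (auto elim!: mrep_homE simp: vee_simps module_repD arrow_dual_comp)

lemma functor_circ:
  "mrep_functor R (d, e, h) (e, d, h) circ circ circ circ_mor circ_mor circ_mor circ_mor"
  unfolding mrep_functor_def
  by (intro conjI allI ballI impI; (elim conjE)?; (rule circ_mor_comp)?)
    (simp_all add: module_rep_circ circ_mor_hom circ_simps)

lemma functor_bullet:
  "mrep_functor R (d, e, h) (opp h, e, opp d) (bullet R) (bullet R) (bullet R)
    (bullet_mor R) (bullet_mor R) (bullet_mor R) (bullet_mor R)"
  unfolding mrep_functor_def
  by (intro conjI allI ballI impI; (elim conjE)?)
    (simp_all add: module_rep_bullet bullet_mor_hom bullet_mor_comp bullet_simps arrow_dual_id
      del: mrep_comp.simps)

lemma functor_vee: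
  "mrep_functor R (d, e, h) (d, opp h, opp e) (vee R) (vee R) (vee R)
    (vee_mor R) (vee_mor R) (vee_mor R) (vee_mor R)"
  unfolding mrep_functor_def
  by (intro conjI allI ballI impI; (elim conjE)?)
    (simp_all add: module_rep_vee vee_mor_hom vee_mor_comp vee_simps arrow_dual_id
      del: mrep_comp.simps)

lemma circ2_mor_eq: "circ2_mor \<theta> \<theta>' t = t"
  by (cases t) (simp add: circ2_mor_def)

lemma functor_circ2:
  "mrep_functor R \<sigma> \<sigma> circ2 circ2 circ2 circ2_mor circ2_mor circ2_mor circ2_mor"
  by (auto simp: mrep_functor_def circ2_def circ_circ circ2_mor_eq)

lemma module_rep_bullet2: "module_rep R \<theta> \<Longrightarrow> module_rep R (bullet2 R \<theta>)"
  by (simp add: bullet2_def module_rep_bullet)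

lemma bullet2_mor_hom:
  assumes "module_rep R \<theta>" "module_rep R \<theta>'" "t \<in> mrep_hom R (d, e, h) \<theta> \<theta>'"
  shows "bullet2_mor R \<theta> \<theta>' t \<in> mrep_hom R (d, e, h) (bullet2 R \<theta>) (bullet2 R \<theta>')"
  using bullet_mor_hom[OF _ _ bullet_mor_hom[OF assms]] assms
  by (simp add: bullet2_mor_def bullet2_def module_rep_bullet opp_opp)

lemma module_rep_vee2: "module_rep R \<theta> \<Longrightarrow> module_rep R (vee2 R \<theta>)"
  by (simp add: vee2_def module_rep_vee)

lemma vee2_mor_hom:
  assumes "module_rep R \<theta>" "module_rep R \<theta>'" "t \<in> mrep_hom R (d, e, h) \<theta> \<theta>'"
  shows "vee2_mor R \<theta> \<theta>' t \<in> mrep_hom R (d, e, h) (vee2 R \<theta>) (vee2 R \<theta>')"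
  using vee_mor_hom[OF _ _ vee_mor_hom[OF assms]] assms
  by (simp add: vee2_mor_def vee2_def module_rep_vee opp_opp)

lemma bullet2_mor_rev:
  "bullet2_mor R \<theta>' \<theta> (arrows_rev t) = arrows_rev (bullet2_mor R \<theta> \<theta>' t)"
  by (cases t) (simp add: bullet2_mor_def bullet_simps arrow_dual_rev)

lemma bullet2_mor_comp:
  assumes "module_rep R \<theta>1" "module_rep R \<theta>2" "module_rep R \<theta>3"
    and "t \<in> mrep_hom R \<sigma> \<theta>1 \<theta>2" "u \<in> mrep_hom R \<sigma> \<theta>2 \<theta>3"
  shows "bullet2_mor R \<theta>1 \<theta>3 (mrep_comp \<theta>1 \<theta>3 t u) =
    mrep_comp (bullet2 R \<theta>1) (bullet2 R \<theta>3) (bullet2_mor R \<theta>1 \<theta>2 t) (bullet2_mor R \<theta>2 \<theta>3 u)"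
proof (cases \<sigma>)
  case (fields d e h)
  note hom = assms(4,5)[unfolded fields]
  show ?thesis
    unfolding bullet2_def bullet2_mor_def bullet_mor_comp[OF assms]
    by (rule bullet_mor_comp[OF module_rep_bullet[OF assms(1)] module_rep_bullet[OF assms(2)]
          module_rep_bullet[OF assms(3)] bullet_mor_hom[OF assms(1,2) hom(1)]
          bullet_mor_hom[OF assms(2,3) hom(2)]])
qed

lemma functor_bullet2:
  "mrep_functor R \<sigma> \<sigma> (bullet2 R) (bullet2 R) (bullet2 R)
    (bullet2_mor R) (bullet2_mor R) (bullet2_mor R) (bullet2_mor R)"
  unfolding mrep_functor_def
  by (cases \<sigma>, intro conjI allI ballI impI; (elim conjE)?)
    (simp_all add: bullet2_mor_hom bullet2_mor_comp del: mrep_comp.simps,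
      simp_all add: bullet2_def bullet2_mor_def module_rep_bullet bullet_simps arrow_dual_id opp_opp)

lemma vee2_mor_rev:
  "vee2_mor R \<theta>' \<theta> (arrows_rev t) = arrows_rev (vee2_mor R \<theta> \<theta>' t)"
  by (cases t) (simp add: vee2_mor_def vee_simps arrow_dual_rev)

lemma vee2_mor_comp:
  assumes "module_rep R \<theta>1" "module_rep R \<theta>2" "module_rep R \<theta>3"
    and "t \<in> mrep_hom R \<sigma> \<theta>1 \<theta>2" "u \<in> mrep_hom R \<sigma> \<theta>2 \<theta>3"
  shows "vee2_mor R \<theta>1 \<theta>3 (mrep_comp \<theta>1 \<theta>3 t u) =
    mrep_comp (vee2 R \<theta>1) (vee2 R \<theta>3) (vee2_mor R \<theta>1 \<theta>2 t) (vee2_mor R \<theta>2 \<theta>3 u)"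
proof (cases \<sigma>)
  case (fields d e h)
  note hom = assms(4,5)[unfolded fields]
  show ?thesis
    unfolding vee2_def vee2_mor_def vee_mor_comp[OF assms]
    by (rule vee_mor_comp[OF module_rep_vee[OF assms(1)] module_rep_vee[OF assms(2)]
          module_rep_vee[OF assms(3)] vee_mor_hom[OF assms(1,2) hom(1)]
          vee_mor_hom[OF assms(2,3) hom(2)]])
qed

lemma functor_vee2:
  "mrep_functor R \<sigma> \<sigma> (vee2 R) (vee2 R) (vee2 R)
    (vee2_mor R) (vee2_mor R) (vee2_mor R) (vee2_mor R)"
  unfolding mrep_functor_def
  by (cases \<sigma>, intro conjI allI ballI impI; (elim conjE)?)
    (simp_all add: vee2_mor_hom vee2_mor_comp del: mrep_comp.simps,
      simp_all add: vee2_def vee2_mor_def module_rep_vee vee_simps arrow_dual_id opp_opp)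

section \<open>Naturality\<close>

lemma eta_circ_eq: "eta_circ \<sigma> \<theta> = mrep_id \<sigma> \<theta>"
  by (cases \<sigma>) (simp add: eta_circ_def)

lemma nat_trans_circ2:
  "mrep_nat_trans R \<sigma> id_ob id_ob id_mor circ2 circ2 circ2_mor (eta_circ \<sigma>) (eta_circ \<sigma>)"
  by (auto simp: mrep_nat_trans_def id_ob_def id_mor_def eta_circ_eq circ2_def circ_circ circ2_mor_eq
      mrep_id_hom mrep_comp_id)

text \<open>
  Evaluated at \<open>\<psi>\<close>, both the product of \<open>x\<close> and \<open>\<epsilon>\<^sub>M a\<close> in \<open>\<theta>\<^sup>\<bullet>\<^sup>\<bullet>\<close> and \<open>\<epsilon>\<^sub>W (x * a)\<close> give
  \<open>\<psi> (x * a)\<close>. The graph of an identity is the diagonal in either direction, which is why the middle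
  string position is arbitrary.
\<close>

lemma eta_bullet_hom:
  assumes \<theta>: "module_rep R \<theta>"
  shows "eta_bullet R (\<up>, e, \<up>) \<theta> \<in> mrep_hom R (\<up>, e, \<up>) \<theta> (bullet2 R \<theta>)"
proof -
  note mods = module_repD(1-3)[OF \<theta>]
  note \<theta>2 = module_rep_bullet[OF module_rep_bullet[OF \<theta>]]
  have "rep (bullet R (bullet R \<theta>)) (eval_map R (modM \<theta>) a) x = eval_map R (modW \<theta>) (rep \<theta> a x)"
    if a: "a \<in> carrier (modM \<theta>)" and x: "x \<in> carrier (modV \<theta>)" for a x
  proof (rule dual_module_eqI)
    note eval = mod_hom_closed[OF eval_map_mod_hom[OF mods(1)] a]
    show "rep (bullet R (bullet R \<theta>)) (eval_map R (modM \<theta>) a) x \<in>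
        carrier (dual_module R (dual_module R (modW \<theta>)))"
      using module_repD(6)[OF \<theta>2, of "eval_map R (modM \<theta>) a" x] eval x by (simp add: bullet_simps)
    show "eval_map R (modW \<theta>) (rep \<theta> a x) \<in> carrier (dual_module R (dual_module R (modW \<theta>)))"
      by (rule mod_hom_closed[OF eval_map_mod_hom[OF mods(3)] module_repD(6)[OF \<theta> a x]])
    fix \<psi> assume \<psi>: "\<psi> \<in> carrier (dual_module R (modW \<theta>))"
    show "rep (bullet R (bullet R \<theta>)) (eval_map R (modM \<theta>) a) x \<psi> =
        eval_map R (modW \<theta>) (rep \<theta> a x) \<psi>"
      using module_repD(6)[OF module_rep_bullet[OF \<theta>], of \<psi> x] \<psi> x a eval
      by (simp add: bullet_simps eval_map_apply module_repD(6)[OF \<theta> a x])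
  qed
  then show ?thesis
    unfolding eta_bullet_def bullet2_def
    by (auto simp: mrep_hom_iff_graph \<theta> \<theta>2 bullet_simps arrow_graph_id arrow_id_hom mods
        eval_map_mod_hom module_repD(6)[OF \<theta>])
qed

lemma arrow_eval_natural:
  assumes "module R A" "module R B" "p \<in> arrow_hom R \<up> A B"
  shows "arrow_comp A (dual_module R (dual_module R B)) p (Fwd (eval_map R B)) =
    arrow_comp A (dual_module R (dual_module R B)) (Fwd (eval_map R A))
      (arrow_dual R (dual_module R A) (dual_module R B) (arrow_dual R A B p))"
  using assms by (auto simp: eval_map_natural)

lemma nat_trans_bullet2:
  "mrep_nat_trans R (\<up>, e, \<up>) id_ob id_ob id_mor (bullet2 R) (bullet2 R) (bullet2_mor R)
    (eta_bullet R (\<up>, e, \<up>)) (eta_bullet R (\<up>, e, \<up>))"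
  unfolding mrep_nat_trans_def id_ob_def id_mor_def
  by (simp add: eta_bullet_hom)
    (auto simp: eta_bullet_def bullet2_def bullet2_mor_def bullet_simps arrow_comp_id
      arrow_eval_natural module_repD simp del: arrow_comp.simps arrow_dual.simps elim!: mrep_homE)

text \<open>
  The circle operation carries the transformation for bullet at \<open>\<theta>\<^sup>\<circ>\<close> to the one for vee at \<open>\<theta>\<close>, so
  that the components of the latter are morphisms because those of the former are.
\<close>

lemma eta_vee_eq: "eta_vee R (d, \<up>, \<up>) \<theta> = circ_mor \<theta>' \<theta>'' (eta_bullet R (\<up>, d, \<up>) (circ \<theta>))"
  by (simp add: eta_vee_def eta_bullet_def circ_simps)

lemma vee2_eq: "module_rep R \<theta> \<Longrightarrow> vee2 R \<theta> = circ (bullet2 R (circ \<theta>))"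
  by (simp add: vee2_def vee_eq bullet2_def circ_circ[OF module_rep_bullet] module_rep_circ)

lemma eta_vee_hom:
  assumes "module_rep R \<theta>"
  shows "eta_vee R (d, \<up>, \<up>) \<theta> \<in> mrep_hom R (d, \<up>, \<up>) \<theta> (vee2 R \<theta>)"
  using circ_mor_hom[OF module_rep_circ[OF assms] _ eta_bullet_hom[OF module_rep_circ[OF assms]]] assms
  by (simp add: eta_vee_eq[of R d \<theta> "circ \<theta>" "bullet R (bullet R (circ \<theta>))"] vee2_eq circ_circ
      bullet2_def module_rep_bullet module_rep_circ)

lemma nat_trans_vee2:
  "mrep_nat_trans R (d, \<up>, \<up>) id_ob id_ob id_mor (vee2 R) (vee2 R) (vee2_mor R)
    (eta_vee R (d, \<up>, \<up>)) (eta_vee R (d, \<up>, \<up>))"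
  unfolding mrep_nat_trans_def id_ob_def id_mor_def
  by (simp add: eta_vee_hom)
    (auto simp: eta_vee_def vee2_def vee2_mor_def vee_simps arrow_comp_id
      arrow_eval_natural module_repD simp del: arrow_comp.simps arrow_dual.simps elim!: mrep_homE)

lemma bar_bar: "bar (bar \<sigma>) = \<sigma>"
  by (cases \<sigma>) (simp add: opp_opp)

text \<open>
  A natural transformation from the identity to \<open>F\<close> is, in the opposite category, one from \<open>F\<close> to the
  identity, provided that \<open>F\<close> commutes with reversal of morphisms. Reading a square backwards exchanges
  its two corners, so the instances of \<open>F\<close> and \<open>\<eta>\<close> at the two triples of carrier types change places.
\<close>

lemma nat_trans_rev:
  fixes F1 :: "('r, 'm1, 'v1, 'w1) mrep \<Rightarrow> ('r, 'm1', 'v1', 'w1') mrep"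
    and F2 :: "('r, 'm2, 'v2, 'w2) mrep \<Rightarrow> ('r, 'm2', 'v2', 'w2') mrep"
  assumes nat: "mrep_nat_trans R \<sigma> id_ob id_ob id_mor F2 F1 F21 \<eta>2 \<eta>1"
    and \<eta>1: "\<And>\<theta>. module_rep R \<theta> \<Longrightarrow> \<eta>1 \<theta> \<in> mrep_hom R \<sigma> \<theta> (F1 \<theta>)"
    and F1: "\<And>\<theta>. module_rep R \<theta> \<Longrightarrow> module_rep R (F1 \<theta>)"
    and F2: "\<And>\<theta>. module_rep R \<theta> \<Longrightarrow> module_rep R (F2 \<theta>)"
    and F21: "\<And>\<theta> \<theta>' t. module_rep R \<theta> \<Longrightarrow> module_rep R \<theta>' \<Longrightarrow> t \<in> mrep_hom R \<sigma> \<theta> \<theta>' \<Longrightarrow>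
      F21 \<theta> \<theta>' t \<in> mrep_hom R \<sigma> (F2 \<theta>) (F1 \<theta>')"
    and F12: "\<And>\<theta> \<theta>' t. F12 \<theta> \<theta>' t = arrows_rev (F21 \<theta>' \<theta> (arrows_rev t))"
  shows "mrep_nat_trans R (bar \<sigma>) F1 F2' F12 id_ob id_ob id_mor
    (\<lambda>\<theta>. arrows_rev (\<eta>1 \<theta>)) (\<lambda>\<theta>. arrows_rev (\<eta>2 \<theta>))"
  unfolding mrep_nat_trans_def id_ob_def id_mor_def
proof (intro conjI allI ballI impI)
  show "arrows_rev (\<eta>1 \<theta>) \<in> mrep_hom R (bar \<sigma>) (F1 \<theta>) \<theta>" if "module_rep R \<theta>" for \<theta>
    by (rule arrows_rev_hom[OF that F1[OF that] \<eta>1[OF that]])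
next
  fix \<theta>1 :: "('r, 'm1, 'v1, 'w1) mrep" and \<theta>2 :: "('r, 'm2, 'v2, 'w2) mrep" and t
  assume t: "t \<in> mrep_hom R (bar \<sigma>) \<theta>1 \<theta>2" and "module_rep R \<theta>1 \<and> module_rep R \<theta>2"
  then have reps: "module_rep R \<theta>1" "module_rep R \<theta>2"
    by auto
  have u: "arrows_rev t \<in> mrep_hom R \<sigma> \<theta>2 \<theta>1"
    using arrows_rev_hom[OF reps t] by (simp only: bar_bar)
  have \<eta>2: "\<eta>2 \<theta>2 \<in> mrep_hom R \<sigma> \<theta>2 (F2 \<theta>2)"
    using nat reps by (simp add: mrep_nat_trans_def id_ob_def)
  have "mrep_comp \<theta>2 (F1 \<theta>1) (arrows_rev t) (\<eta>1 \<theta>1) =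
      mrep_comp \<theta>2 (F1 \<theta>1) (\<eta>2 \<theta>2) (F21 \<theta>2 \<theta>1 (arrows_rev t))"
    using nat reps u by (simp add: mrep_nat_trans_def id_ob_def id_mor_def)
  then have "arrows_rev (mrep_comp \<theta>2 (F1 \<theta>1) (arrows_rev t) (\<eta>1 \<theta>1)) =
      arrows_rev (mrep_comp \<theta>2 (F1 \<theta>1) (\<eta>2 \<theta>2) (F21 \<theta>2 \<theta>1 (arrows_rev t)))"
    by simp
  then show "mrep_comp (F1 \<theta>1) \<theta>2 (F12 \<theta>1 \<theta>2 t) (arrows_rev (\<eta>2 \<theta>2)) =
      mrep_comp (F1 \<theta>1) \<theta>2 (arrows_rev (\<eta>1 \<theta>1)) t"
    unfolding mrep_comp_rev[OF reps(2,1) F1[OF reps(1)] u \<eta>1[OF reps(1)]]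
      mrep_comp_rev[OF reps(2) F2[OF reps(2)] F1[OF reps(1)] \<eta>2 F21[OF reps(2,1) u]]
    by (simp add: F12 arrows_rev_rev)
qed

lemma nat_trans_bullet2_rev:
  "mrep_nat_trans R (bar (\<up>, e, \<up>)) (bullet2 R) (bullet2 R) (bullet2_mor R) id_ob id_ob id_mor
    (\<lambda>\<theta>. arrows_rev (eta_bullet R (\<up>, e, \<up>) \<theta>)) (\<lambda>\<theta>. arrows_rev (eta_bullet R (\<up>, e, \<up>) \<theta>))"
  by (rule nat_trans_rev, rule nat_trans_bullet2)
    (simp_all add: eta_bullet_hom module_rep_bullet2 bullet2_mor_hom bullet2_mor_rev arrows_rev_rev)

lemma nat_trans_vee2_rev:
  "mrep_nat_trans R (bar (d, \<up>, \<up>)) (vee2 R) (vee2 R) (vee2_mor R) id_ob id_ob id_mor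
    (\<lambda>\<theta>. arrows_rev (eta_vee R (d, \<up>, \<up>) \<theta>)) (\<lambda>\<theta>. arrows_rev (eta_vee R (d, \<up>, \<up>) \<theta>))"
  by (rule nat_trans_rev, rule nat_trans_vee2)
    (simp_all add: eta_vee_hom module_rep_vee2 vee2_mor_hom vee2_mor_rev arrows_rev_rev)

section \<open>The four categories attached to each operation\<close>

theorem proposition4p1:
  fixes R :: "('r, 'z) ring_scheme"
  assumes "cring R"
  shows
    "((\<forall>(\<sigma>, \<sigma>') \<in> {((\<up>, \<up>, \<up>), \<tau>_circ), (\<tau>_circ, (\<up>, \<up>, \<up>)),
          ((\<down>, \<down>, \<down>), bar \<tau>_circ), (bar \<tau>_circ, (\<down>, \<down>, \<down>))}.
        mrep_functor R \<sigma> \<sigma>' circ circ circ circ_mor circ_mor circ_mor circ_mor) \<and>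
      (\<forall>(\<sigma>, \<sigma>') \<in> {((\<up>, \<up>, \<up>), \<tau>_bullet), (\<tau>_bullet, (\<up>, \<up>, \<up>)),
          ((\<down>, \<down>, \<down>), bar \<tau>_bullet), (bar \<tau>_bullet, (\<down>, \<down>, \<down>))}.
        mrep_functor R \<sigma> \<sigma>' (bullet R) (bullet R) (bullet R)
          (bullet_mor R) (bullet_mor R) (bullet_mor R) (bullet_mor R)) \<and>
      (\<forall>(\<sigma>, \<sigma>') \<in> {((\<up>, \<up>, \<up>), \<tau>_vee), (\<tau>_vee, (\<up>, \<up>, \<up>)),
          ((\<down>, \<down>, \<down>), bar \<tau>_vee), (bar \<tau>_vee, (\<down>, \<down>, \<down>))}.
        mrep_functor R \<sigma> \<sigma>' (vee R) (vee R) (vee R)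
          (vee_mor R) (vee_mor R) (vee_mor R) (vee_mor R))) \<and>
     ((\<forall>\<sigma> \<in> {(\<up>, \<up>, \<up>), (\<down>, \<down>, \<down>), \<tau>_circ, bar \<tau>_circ}.
        mrep_functor R \<sigma> \<sigma> circ2 circ2 circ2 circ2_mor circ2_mor circ2_mor circ2_mor \<and>
        mrep_nat_trans R \<sigma> id_ob id_ob id_mor circ2 circ2 circ2_mor (eta_circ \<sigma>) (eta_circ \<sigma>)) \<and>
      (\<forall>\<sigma> \<in> {(\<up>, \<up>, \<up>), (\<down>, \<down>, \<down>), \<tau>_bullet, bar \<tau>_bullet}.
        mrep_functor R \<sigma> \<sigma> (bullet2 R) (bullet2 R) (bullet2 R)
          (bullet2_mor R) (bullet2_mor R) (bullet2_mor R) (bullet2_mor R)) \<and>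
      (\<forall>\<sigma> \<in> {(\<up>, \<up>, \<up>), bar \<tau>_bullet}.
        mrep_nat_trans R \<sigma> id_ob id_ob id_mor (bullet2 R) (bullet2 R) (bullet2_mor R)
          (eta_bullet R \<sigma>) (eta_bullet R \<sigma>)) \<and>
      (\<forall>\<sigma> \<in> {(\<down>, \<down>, \<down>), \<tau>_bullet}.
        mrep_nat_trans R \<sigma> (bullet2 R) (bullet2 R) (bullet2_mor R) id_ob id_ob id_mor
          (\<lambda>\<theta>. arrows_rev (eta_bullet R (bar \<sigma>) \<theta>)) (\<lambda>\<theta>. arrows_rev (eta_bullet R (bar \<sigma>) \<theta>))) \<and>
      (\<forall>\<sigma> \<in> {(\<up>, \<up>, \<up>), (\<down>, \<down>, \<down>), \<tau>_vee, bar \<tau>_vee}.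
        mrep_functor R \<sigma> \<sigma> (vee2 R) (vee2 R) (vee2 R)
          (vee2_mor R) (vee2_mor R) (vee2_mor R) (vee2_mor R)) \<and>
      (\<forall>\<sigma> \<in> {(\<up>, \<up>, \<up>), bar \<tau>_vee}.
        mrep_nat_trans R \<sigma> id_ob id_ob id_mor (vee2 R) (vee2 R) (vee2_mor R)
          (eta_vee R \<sigma>) (eta_vee R \<sigma>)) \<and>
      (\<forall>\<sigma> \<in> {(\<down>, \<down>, \<down>), \<tau>_vee}.
        mrep_nat_trans R \<sigma> (vee2 R) (vee2 R) (vee2_mor R) id_ob id_ob id_mor
          (\<lambda>\<theta>. arrows_rev (eta_vee R (bar \<sigma>) \<theta>)) (\<lambda>\<theta>. arrows_rev (eta_vee R (bar \<sigma>) \<theta>))))"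
  unfolding \<tau>_circ_def \<tau>_bullet_def \<tau>_vee_def
  using functor_circ[of R \<up> \<up> \<up>] functor_circ[of R \<down> \<down> \<down>]
    functor_bullet[of R \<up> \<up> \<up>] functor_bullet[of R \<down> \<up> \<down>]
    functor_bullet[of R \<down> \<down> \<down>] functor_bullet[of R \<up> \<down> \<up>]
    functor_vee[of R \<up> \<up> \<up>] functor_vee[of R \<up> \<down> \<down>]
    functor_vee[of R \<down> \<down> \<down>] functor_vee[of R \<down> \<up> \<up>]
    nat_trans_bullet2_rev[of R \<up>] nat_trans_bullet2_rev[of R \<down>]
    nat_trans_vee2_rev[of R \<up>] nat_trans_vee2_rev[of R \<down>]
  by (simp add: functor_circ2 functor_bullet2 functor_vee2
      nat_trans_circ2 nat_trans_bullet2 nat_trans_vee2)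

end
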